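(* Fix an integer $k\ge 1$. Let $\lambda_k$ be the $k$-th eigenvalue of $\mathcal{L}=\big(\frac{d}{dx}\big)^4$ on $[0,1]$ with homogeneous Dirichlet boundary conditions, and for $h=\frac1N$, $N=k+1,k+2,\ldots$, let $\lambda_{h,k}$ be the $k$-th eigenvalue of the discrete biharmonic operator $\delta_x^4$ with mesh size $h$. Then there exists a constant $C>0$, depending only on $k$, such that $$|\lambda_k-\lambda_{h,k}|\le C h^4$$ for all such $h$.
   Context: Continuous operator: $\mathcal{L}u=u''''$ on $L^2(0,1)$ with domain $H^4([0,1])\cap H^2_0([0,1])$, i.e. with $u(0)=u'(0)=u(1)=u'(1)=0$. It is self-adjoint and positive definite, with compact resolvent; its eigenvalues are simple and are listed as $0<\lambda_1<\lambda_2<\cdots$. Discrete operator: for $h=1/N$, the grid is $x_j=jh$, $0\le j\le N$; $l^2_{h,0}$ is the space of grid functions $\mathfrak{v}=(\mathfrak{v}_j)_{j=0}^N$ with $\mathfrak{v}_0=\mathfrak{v}_N=0$. For $1\le j\le N-1$: $(\delta_x\mathfrak{v})_j=\frac{\mathfrak{v}_{j+1}-\mathfrak{v}_{j-1}}{2h}$ and $(\delta_x^2\mathfrak{v})_j=\frac{\mathfrak{v}_{j+1}-2\mathfrak{v}_j+\mathfrak{v}_{j-1}}{h^2}$. The Hermitian derivative $\mathfrak{u}_x$ of $\mathfrak{u}\in l^2_{h,0}$ is the unique element of $l^2_{h,0}$ with $\tfrac16(\mathfrak{u}_x)_{j-1}+\tfrac23(\mathfrak{u}_x)_j+\tfrac16(\mathfrak{u}_x)_{j+1}=(\delta_x\mathfrak{u})_j$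 for $1\le j\le N-1$. The discrete biharmonic operator is $$(\delta_x^4\mathfrak{u})_j=\frac{12}{h^2}\big[(\delta_x\mathfrak{u}_x)_j-(\delta_x^2\mathfrak{u})_j\big],\qquad 1\le j\le N-1,$$ regarded as a map $l^2_{h,0}\to l^2_{h,0}$. It is symmetric and positive definite, and its eigenvalues, repeated according to multiplicity, are $0<\lambda_{h,1}\le\lambda_{h,2}\le\cdots\le\lambda_{h,N-1}$. *)

theory Defs
  imports "HOL-Analysis.Analysis" "HOL-Library.Function_Algebras"
begin

section \<open>The continuous operator\<close>

text \<open>\<open>u\<close> is absolutely continuous on \<open>[0,1]\<close> with almost-everywhere derivative \<open>v\<close>.\<close>

definition abs_cont_deriv :: "(real \<Rightarrow> real) \<Rightarrow> (real \<Rightarrow> real) \<Rightarrow> bool" where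
  "abs_cont_deriv u v \<longleftrightarrow>
     integrable (lebesgue_on {0..1}) v \<and>
     (\<forall>x\<in>{0..1}. u x = u 0 + integral\<^sup>L (lebesgue_on {0..x}) v)"

definition L2_unit :: "(real \<Rightarrow> real) set" where
  "L2_unit = {f. f \<in> borel_measurable (lebesgue_on {0..1}) \<and>
                 integrable (lebesgue_on {0..1}) (\<lambda>x. (f x)\<^sup>2)}"

text \<open>The graph of \<open>u \<mapsto> u''''\<close> on \<open>H\<^sup>4([0,1]) \<inter> H\<^sup>2\<^sub>0([0,1])\<close>. As usual in one dimension, an element
  of \<open>H\<^sup>4([0,1])\<close> is identified with its continuous representative: the derivatives of order
  \<open>< 4\<close> are absolutely continuous, so that their boundary values make sense, and the fourth one
  is in \<open>L\<^sup>2(0,1)\<close>. The derivatives \<open>u1, u2, u3\<close> are determined by \<open>u\<close> everywhere on \<open>[0,1]\<close>,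
  while \<open>f\<close> is determined only almost everywhere.\<close>

definition biharmonic :: "(real \<Rightarrow> real) \<Rightarrow> (real \<Rightarrow> real) \<Rightarrow> bool" where
  "biharmonic u f \<longleftrightarrow>
     (\<exists>u1 u2 u3. abs_cont_deriv u u1 \<and> abs_cont_deriv u1 u2 \<and>
        abs_cont_deriv u2 u3 \<and> abs_cont_deriv u3 f \<and> f \<in> L2_unit \<and>
        u 0 = 0 \<and> u1 0 = 0 \<and> u 1 = 0 \<and> u1 1 = 0)"

definition biharmonic_spectrum :: "real set" where
  "biharmonic_spectrum = {\<mu>. \<exists>u f. biharmonic u f \<and>
      (AE x in lebesgue_on {0..1}. f x = \<mu> * u x) \<and>
      \<not> (AE x in lebesgue_on {0..1}. u x = 0)}"

text \<open>The eigenvalues are simple, so they are listed as a strictly increasing sequence;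
  \<open>k\<close> counts from \<open>1\<close>.\<close>

definition biharmonic_eigenvalue :: "nat \<Rightarrow> real" where
  "biharmonic_eigenvalue k =
     (THE lam :: nat \<Rightarrow> real. strict_mono lam \<and> range lam = biharmonic_spectrum) (k - 1)"


section \<open>The discrete operator\<close>

definition mesh :: "nat \<Rightarrow> real" where
  "mesh N = 1 / real N"

text \<open>A grid function on \<open>x\<^sub>0, \<dots>, x\<^sub>N\<close> is extended by \<open>0\<close> to indices beyond \<open>N\<close>; the difference
  operators below are likewise set to \<open>0\<close> outside the interior indices.\<close>

definition grid0 :: "nat \<Rightarrow> (nat \<Rightarrow> real) set" where
  "grid0 N = {v. v 0 = 0 \<and> (\<forall>j\<ge>N. v j = 0)}"

definition delta_x :: "nat \<Rightarrow> (nat \<Rightarrow> real) \<Rightarrow> nat \<Rightarrow> real" where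
  "delta_x N v j =
     (if 1 \<le> j \<and> j \<le> N - 1 then (v (j + 1) - v (j - 1)) / (2 * mesh N) else 0)"

definition delta_x2 :: "nat \<Rightarrow> (nat \<Rightarrow> real) \<Rightarrow> nat \<Rightarrow> real" where
  "delta_x2 N v j =
     (if 1 \<le> j \<and> j \<le> N - 1 then (v (j + 1) - 2 * v j + v (j - 1)) / (mesh N)\<^sup>2 else 0)"

definition hermitian_deriv :: "nat \<Rightarrow> (nat \<Rightarrow> real) \<Rightarrow> nat \<Rightarrow> real" where
  "hermitian_deriv N u = (THE p. p \<in> grid0 N \<and>
     (\<forall>j\<in>{1..N - 1}. 1/6 * p (j - 1) + 2/3 * p j + 1/6 * p (j + 1) = delta_x N u j))"

definition delta_x4 :: "nat \<Rightarrow> (nat \<Rightarrow> real) \<Rightarrow> nat \<Rightarrow> real" where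
  "delta_x4 N u j =
     12 / (mesh N)\<^sup>2 * (delta_x N (hermitian_deriv N u) j - delta_x2 N u j)"

definition discrete_eigenspace :: "nat \<Rightarrow> real \<Rightarrow> (nat \<Rightarrow> real) set" where
  "discrete_eigenspace N \<mu> = {v \<in> grid0 N. \<forall>j. delta_x4 N v j = \<mu> * v j}"

definition discrete_multiplicity :: "nat \<Rightarrow> real \<Rightarrow> nat" where
  "discrete_multiplicity N \<mu> =
     vector_space.dim (\<lambda>(c::real) (v::nat \<Rightarrow> real) j. c * v j) (discrete_eigenspace N \<mu>)"

definition discrete_eigenvalues :: "nat \<Rightarrow> real list" where
  "discrete_eigenvalues N =
     (THE xs. sorted xs \<and> (\<forall>\<mu>. count_list xs \<mu> = discrete_multiplicity N \<mu>))"

definition discrete_eigenvalue :: "nat \<Rightarrow> nat \<Rightarrow> real" where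
  "discrete_eigenvalue N k = discrete_eigenvalues N ! (k - 1)"

end

theory Submission
  imports Defs "HOL-Real_Asymp.Real_Asymp"
begin

text \<open>Both eigenvalue problems have constant coefficients, so both can be solved in closed form, and
the theorem reduces to comparing the roots of two transcendental equations.

For the beam, an eigenvalue must be positive, \<open>\<mu> = w\<^sup>4\<close>, and an eigenfunction with the right values at
\<open>0\<close> is a combination of \<open>cosh (w x) - cos (w x)\<close> and \<open>sinh (w x) - sin (w x)\<close>. The conditions at \<open>1\<close>
then leave the equation \<open>cos w cosh w = 1\<close>. The second derivative of \<open>D w = cos w cosh w - 1\<close>
is \<open>- 2 sin w sinh w\<close>, so \<open>D\<close> is alternately concave and convex on the intervals
\<open>[k \<pi>, (k + 1) \<pi>]\<close> and changes sign across each of them with \<open>k \<ge> 1\<close>; hence it has exactly one root \<open>w\<^sub>k\<close> there, and none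
in \<open>(0, \<pi>]\<close>. So \<open>\<lambda>\<^sub>k = w\<^sub>k\<^sup>4\<close>. Concavity also gives \<open>|a - w\<^sub>k| \<le> const |D a|\<close> on the \<open>k\<close>-th interval
(\<open>clamped_root_distance\<close>), which is the stability estimate of the proof.

For the difference scheme, substituting \<open>e\<^sup>i\<^sup>\<theta>\<^sup>j\<close> gives the dispersion relation
\<open>h\<^sup>4 \<mu> = 12 (1 - cos \<theta>)\<^sup>2 / (2 + cos \<theta>)\<close>. The same \<open>\<mu>\<close> is produced by a real exponential \<open>e\<^sup>\<phi>\<^sup>j\<close>
with \<open>cosh \<phi> = (5 - 2 cos \<theta>) / (2 + cos \<theta>)\<close>, because the dispersion relation is quadratic in
\<open>cos \<theta>\<close>. These four exponentials build an eigenvector exactly when a characteristic function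
of \<open>\<theta>\<close> vanishes. That function alternates in sign at the points \<open>j \<pi> / N\<close>, \<open>1 \<le> j \<le> N\<close>, so it has a root
\<open>\<theta>\<^sub>k\<close> between \<open>k \<pi> / N\<close> and \<open>(k + 1) \<pi> / N\<close> for each \<open>1 \<le> k < N\<close>. This produces
\<open>N - 1\<close> distinct eigenvalues in a space of dimension \<open>N - 1\<close>: there are no others, all are
simple, and the \<open>k\<close>-th one belongs to \<open>\<theta>\<^sub>k\<close>. The interval that contains \<open>N \<theta>\<^sub>k\<close> is also the
one that contains \<open>w\<^sub>k\<close>, so the two numberings agree.

Finally put \<open>a = N \<theta>\<^sub>k\<close> and \<open>b = N \<phi>\<close>. Both lie within a bounded range for fixed \<open>k\<close>, and the Hermitian derivative is accurate
enough that \<open>\<phi> - \<theta> = O(\<theta>\<^sup>5)\<close> and \<open>h\<^sup>4 \<mu> - \<theta>\<^sup>4 = O(\<theta>\<^sup>8)\<close>, while the discrete equation differs from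
\<open>cos a cosh b = 1\<close> by \<open>O(\<theta>\<^sup>4)\<close>. Hence \<open>D a = O(h\<^sup>4)\<close>, so \<open>a - w\<^sub>k = O(h\<^sup>4)\<close>, and the eigenvalues, which are
\<open>a\<^sup>4 + O(h\<^sup>4)\<close> and \<open>w\<^sub>k\<^sup>4\<close>, differ by \<open>O(h\<^sup>4)\<close>.\<close>

section \<open>The roots of the characteristic equation\<close>

definition clamped_char :: "real \<Rightarrow> real" where
  "clamped_char w = cos w * cosh w - 1"

lemma sign_sin_nonneg:
  assumes "real k * pi \<le> x" "x \<le> (real k + 1) * pi"
  shows "(-1) ^ k * sin x \<ge> 0"
proof -
  define y where "y = x - real k * pi"
  have x: "x = y + real k * pi" by (simp add: y_def)
  have y: "0 \<le> y" "y \<le> pi" using assms by (auto simp: y_def algebra_simps)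
  have "(-1) ^ k * sin x = ((-1) ^ k * (-1) ^ k) * sin y"
    unfolding x sin_add by (simp add: sin_npi cos_npi)
  also have "\<dots> = sin y" by (simp flip: power_mult_distrib)
  finally show ?thesis using sin_ge_zero y by simp
qed

lemma concave_clamped_char:
  "concave_on {real k * pi..(real k + 1) * pi} (\<lambda>x. (-1) ^ k * clamped_char x)"
proof (rule f''_le0_imp_concave)
  fix x assume x: "x \<in> {real k * pi..(real k + 1) * pi}"
  show "((\<lambda>x. (-1) ^ k * clamped_char x) has_real_derivative
      (-1) ^ k * (cos x * sinh x - sin x * cosh x)) (at x)"
    unfolding clamped_char_def by (auto intro!: derivative_eq_intros simp: algebra_simps)
  show "((\<lambda>x. (-1) ^ k * (cos x * sinh x - sin x * cosh x)) has_real_derivative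
      - 2 * ((-1) ^ k * sin x) * sinh x) (at x)"
    by (auto intro!: derivative_eq_intros simp: algebra_simps)
  have "0 \<le> real k * pi" by simp
  also have "\<dots> \<le> x" using x by simp
  finally have "x \<ge> 0" .
  then show "- 2 * ((-1) ^ k * sin x) * sinh x \<le> 0"
    using sign_sin_nonneg[of k x] x mult_nonneg_nonneg[of "(-1) ^ k * sin x" "sinh x"] by auto
qed simp

text \<open>A concave function that is positive at the left end lies above its chord before its zero and below
the extension of that chord after it, so it leaves its zero at least as steeply as the chord.\<close>

lemma concave_zero_distance:
  fixes f :: "real \<Rightarrow> real"
  assumes conc: "concave_on {l..r} f" and fl: "f l > 0"
    and w: "w \<in> {l..r}" "f w = 0" and x: "x \<in> {l..r}"
  shows "f l * \<bar>x - w\<bar> \<le> (r - l) * \<bar>f x\<bar>"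
proof -
  have lw: "l < w" using w fl by (cases "w = l") auto
  have le: "(w - l) * \<bar>f x\<bar> \<le> (r - l) * \<bar>f x\<bar>"
    using w by (intro mult_right_mono) auto
  show ?thesis
  proof (cases "x \<le> w")
    case True
    define t where "t = (x - l) / (w - l)"
    have t: "0 \<le> t" "t \<le> 1" using True x lw by (auto simp: t_def)
    have "t * (w - l) = x - l" using lw by (simp add: t_def)
    then have xt: "x = (1 - t) * l + t * w" by algebra
    have "(1 - t) * f l \<le> f x"
      using concave_onD[OF conc t, of l w] w x xt by auto
    moreover have "(1 - t) * (w - l) = w - x"
      using lw by (simp add: t_def field_simps)
    ultimately have "(w - x) * f l \<le> (w - l) * f x"
      using lw mult_left_mono[of "(1 - t) * f l" "f x" "w - l"]
      by (metis (no_types, lifting) less_eq_real_def diff_gt_0_iff_gt mult.assoc mult.commute)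
    also have "\<dots> \<le> (w - l) * \<bar>f x\<bar>" using lw by (intro mult_left_mono) auto
    finally show ?thesis using le True by (simp add: mult.commute)
  next
    case False
    define t where "t = (w - l) / (x - l)"
    have lx: "l < x" using False lw by simp
    have t: "0 \<le> t" "t \<le> 1" using False lw by (auto simp: t_def)
    have tx: "t * (x - l) = w - l" using lx by (simp add: t_def)
    then have wt: "w = (1 - t) * l + t * x" by algebra
    have "(1 - t) * f l + t * f x \<le> 0"
      using concave_onD[OF conc t, of l x] w x wt by auto
    then have "(x - l) * ((1 - t) * f l + t * f x) \<le> 0"
      using lx by (simp add: mult_nonneg_nonpos)
    moreover have "(x - l) * ((1 - t) * f l + t * f x) = (x - w) * f l + (w - l) * f x"
      using tx by algebra
    ultimately have "(x - w) * f l \<le> (w - l) * (- f x)" by simp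
    also have "\<dots> \<le> (w - l) * \<bar>f x\<bar>" using lw by (intro mult_left_mono) auto
    finally show ?thesis using le False by (simp add: mult.commute)
  qed
qed

lemma clamped_char_left:
  "(-1) ^ k * clamped_char (real k * pi) = cosh (real k * pi) - (-1) ^ k"
  by (simp add: clamped_char_def cos_npi algebra_simps flip: power_mult_distrib)

lemma minus_one_power_le_one: "(-1 :: real) ^ k \<le> 1"
  by (cases "even k") auto

lemma cosh_gt_one: "(x::real) > 0 \<Longrightarrow> cosh x > 1"
  using cosh_real_strict_mono[of 0 x] by simp

lemma clamped_char_left_pos:
  assumes "k \<ge> 1" shows "(-1) ^ k * clamped_char (real k * pi) > 0"
  using cosh_gt_one[of "real k * pi"] minus_one_power_le_one[of k] assms
  unfolding clamped_char_left by simp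

text \<open>Existence is the change of sign between the ends; uniqueness is the distance estimate applied to two zeros.\<close>

lemma ex1_clamped_root:
  assumes k: "k \<ge> 1"
  shows "\<exists>!w. w \<in> {real k * pi..(real k + 1) * pi} \<and> clamped_char w = 0"
proof -
  let ?I = "{real k * pi..(real k + 1) * pi}"
  let ?f = "\<lambda>x. (-1) ^ k * clamped_char x"
  have "(-1) ^ Suc k * clamped_char (real (Suc k) * pi) > 0"
    by (rule clamped_char_left_pos) simp
  then have right: "?f ((real k + 1) * pi) < 0" by (simp add: add.commute)
  have "\<exists>w\<ge>real k * pi. w \<le> (real k + 1) * pi \<and> ?f w = 0"
    using clamped_char_left_pos[OF k] right
    by (intro IVT2') (auto intro!: continuous_intros simp: clamped_char_def algebra_simps)
  then obtain w where w: "w \<in> ?I" "clamped_char w = 0" by auto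
  show ?thesis
  proof (rule ex1I[of _ w])
    fix x assume x: "x \<in> ?I \<and> clamped_char x = 0"
    have "?f (real k * pi) * \<bar>x - w\<bar> \<le> ((real k + 1) * pi - real k * pi) * \<bar>?f x\<bar>"
      using w x clamped_char_left_pos[OF k]
      by (intro concave_zero_distance[OF concave_clamped_char]) auto
    then have "?f (real k * pi) * \<bar>x - w\<bar> \<le> 0" using x by simp
    then have "\<bar>x - w\<bar> \<le> 0"
      using clamped_char_left_pos[OF k] by (meson mult_pos_pos not_le)
    then show "x = w" by simp
  qed (use w in auto)
qed

definition clamped_root :: "nat \<Rightarrow> real" where
  "clamped_root k = (THE w. w \<in> {real k * pi..(real k + 1) * pi} \<and> clamped_char w = 0)"

lemma clamped_root:
  assumes "k \<ge> 1"
  shows "clamped_root k \<in> {real k * pi<..<(real k + 1) * pi}" "clamped_char (clamped_root k) = 0"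
proof -
  have *: "clamped_root k \<in> {real k * pi..(real k + 1) * pi} \<and> clamped_char (clamped_root k) = 0"
    unfolding clamped_root_def by (rule theI'[OF ex1_clamped_root[OF assms]])
  then show "clamped_char (clamped_root k) = 0" by simp
  have "clamped_char (real k * pi) \<noteq> 0" "clamped_char (real (Suc k) * pi) \<noteq> 0"
    using clamped_char_left_pos[of k] clamped_char_left_pos[of "Suc k"] assms by auto
  then have "clamped_root k \<noteq> real k * pi" "clamped_root k \<noteq> (real k + 1) * pi"
    using * by (auto simp: add.commute)
  then show "clamped_root k \<in> {real k * pi<..<(real k + 1) * pi}"
    using * by auto
qed

text \<open>Stability of the root: a small residual in the characteristic equation forces closeness to the root.\<close>

lemma clamped_root_distance:
  assumes "k \<ge> 1" "x \<in> {real k * pi..(real k + 1) * pi}"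
  shows "(cosh (real k * pi) - 1) * \<bar>x - clamped_root k\<bar> \<le> pi * \<bar>clamped_char x\<bar>"
proof -
  let ?f = "\<lambda>x. (-1) ^ k * clamped_char x"
  have "?f (real k * pi) * \<bar>x - clamped_root k\<bar>
      \<le> ((real k + 1) * pi - real k * pi) * \<bar>?f x\<bar>"
    using assms clamped_root[OF assms(1)] clamped_char_left_pos
    by (intro concave_zero_distance[OF concave_clamped_char]) auto
  then have 1: "?f (real k * pi) * \<bar>x - clamped_root k\<bar> \<le> pi * \<bar>clamped_char x\<bar>"
    by (simp add: abs_mult algebra_simps)
  have "(cosh (real k * pi) - 1) * \<bar>x - clamped_root k\<bar> \<le> ?f (real k * pi) * \<bar>x - clamped_root k\<bar>"
    unfolding clamped_char_left using minus_one_power_le_one[of k]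
    by (intro mult_right_mono) auto
  with 1 show ?thesis by linarith
qed

text \<open>The point \<open>0\<close> is itself a zero, so the sign on \<open>(0, \<pi>]\<close> needs two monotonicity steps: the second
derivative is negative there, hence so is the first, hence the function decreases from \<open>0\<close>.\<close>

lemma clamped_char_neg:
  assumes "0 < w" "w \<le> pi"
  shows "clamped_char w < 0"
proof -
  have "clamped_char w < clamped_char 0"
  proof (rule DERIV_neg_imp_decreasing_open[OF assms(1)])
    fix x assume x: "0 < x" "x < w"
    have "cos x * sinh x - sin x * cosh x < cos 0 * sinh 0 - sin 0 * cosh (0::real)"
    proof (rule DERIV_neg_imp_decreasing_open[OF x(1)])
      fix y assume y: "0 < y" "y < x"
      have "sin y * sinh y > 0" using x y assms by (intro mult_pos_pos sin_gt_zero) auto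
      moreover have "((\<lambda>x. cos x * sinh x - sin x * cosh x) has_real_derivative
          - 2 * (sin y * sinh y)) (at y)"
        by (auto intro!: derivative_eq_intros)
      ultimately show "\<exists>d. ((\<lambda>x. cos x * sinh x - sin x * cosh x) has_real_derivative d) (at y) \<and> d < 0"
        by (intro exI[of _ "- 2 * (sin y * sinh y)"]) auto
    qed (intro continuous_intros)
    moreover have "(clamped_char has_real_derivative cos x * sinh x - sin x * cosh x) (at x)"
      unfolding clamped_char_def[abs_def] by (auto intro!: derivative_eq_intros)
    ultimately show "\<exists>d. (clamped_char has_real_derivative d) (at x) \<and> d < 0" by auto
  qed (auto simp: clamped_char_def[abs_def] intro!: continuous_intros)
  then show ?thesis by (simp add: clamped_char_def)
qed

lemma clamped_char_zeros:
  assumes "w > 0" "clamped_char w = 0"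
  shows "\<exists>k\<ge>1. w = clamped_root k"
proof -
  define k where "k = nat \<lfloor>w / pi\<rfloor>"
  have nn: "0 \<le> \<lfloor>w / pi\<rfloor>" using assms by simp
  have fl: "real k = of_int \<lfloor>w / pi\<rfloor>" unfolding k_def using nn by simp
  have "real k \<le> w / pi" "w / pi \<le> real k + 1" unfolding fl by linarith+
  then have I: "w \<in> {real k * pi..(real k + 1) * pi}" by (auto simp: field_simps)
  have "k \<noteq> 0" using clamped_char_neg[of w] I assms by (cases "k = 0") auto
  then have k1: "k \<ge> 1" by simp
  have "cosh (real k * pi) > 1" using cosh_gt_one[of "real k * pi"] k1 by simp
  then have "w = clamped_root k"
    using clamped_root_distance[OF k1 I] assms(2) by (simp add: mult_le_0_iff)
  with k1 show ?thesis by blast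
qed

lemma clamped_root_pos: "k \<ge> 1 \<Longrightarrow> clamped_root k > 0"
  using clamped_root(1)[of k] by (auto intro: le_less_trans[of 0 "real k * pi"])

lemma clamped_root_less_Suc:
  assumes "k \<ge> 1" shows "clamped_root k < clamped_root (Suc k)"
  using clamped_root(1)[OF assms] clamped_root(1)[of "Suc k"] by (auto simp: add.commute)

section \<open>The continuous spectrum\<close>

lemma abs_cont_derivD:
  assumes "abs_cont_deriv u v"
  shows "integrable (lebesgue_on {0..1}) v"
    and "x \<in> {0..1} \<Longrightarrow> u x = u 0 + integral\<^sup>L (lebesgue_on {0..x}) v"
  using assms unfolding abs_cont_deriv_def by blast+

lemma abs_cont_deriv_continuous:
  assumes "abs_cont_deriv u v"
  shows "continuous_on {0..1} u"
proof -
  have "continuous_on {0..1} (\<lambda>x. u 0 + integral\<^sup>L (lebesgue_on {0..x}) v)"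
    by (intro continuous_on_add continuous_on_const indefinite_integral_continuous_real
        abs_cont_derivD(1)[OF assms])
  then show ?thesis
    by (rule continuous_on_eq) (rule abs_cont_derivD(2)[OF assms, symmetric])
qed

text \<open>With a continuous derivative, absolute continuity is nothing but the fundamental theorem of
calculus, so that regularity bootstraps: this turns the Sobolev formulation into a classical one.\<close>

lemma abs_cont_deriv_iff_DERIV:
  assumes cont: "continuous_on {0..1} v"
  shows "abs_cont_deriv u v \<longleftrightarrow>
    (\<forall>x\<in>{0..1}. (u has_real_derivative v x) (at x within {0..1}))"
proof -
  have int: "integrable (lebesgue_on {0..x}) v" if "x \<in> {0..1}" for x
    using that by (intro continuous_imp_integrable_real continuous_on_subset[OF cont]) auto
  have int_eq: "integral\<^sup>L (lebesgue_on {0..x}) v = integral {0..x} v" if "x \<in> {0..1}" for x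
    using int[OF that] by (intro lebesgue_integral_eq_integral) auto
  show ?thesis
  proof (intro iffI ballI)
    fix x :: real assume *: "abs_cont_deriv u v" and x: "x \<in> {0..1}"
    have "((\<lambda>y. u 0 + integral {0..y} v) has_vector_derivative v x) (at x within {0..1})"
      using has_vector_derivative_add[OF has_vector_derivative_const integral_has_vector_derivative[OF cont x]]
      by simp
    moreover have "u y = u 0 + integral {0..y} v" if "y \<in> {0..1}" for y
      using abs_cont_derivD(2)[OF * that] int_eq[OF that] by simp
    ultimately have "(u has_vector_derivative v x) (at x within {0..1})"
      by (rule has_vector_derivative_transform[OF x, rotated])
    then show "(u has_real_derivative v x) (at x within {0..1})"
      by (simp add: has_real_derivative_iff_has_vector_derivative)
  next
    assume *: "\<forall>x\<in>{0..1}. (u has_real_derivative v x) (at x within {0..1})"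
    have "u x = u 0 + integral\<^sup>L (lebesgue_on {0..x}) v" if x: "x \<in> {0..1}" for x
    proof -
      have "(v has_integral u x - u 0) {0..x}"
      proof (rule fundamental_theorem_of_calculus)
        fix y assume "y \<in> {0..x}"
        then have "(u has_real_derivative v y) (at y within {0..x})"
          using * x by (intro DERIV_subset[of u "v y" y "{0..1}" "{0..x}"]) auto
        then show "(u has_vector_derivative v y) (at y within {0..x})"
          by (simp add: has_real_derivative_iff_has_vector_derivative)
      qed (use x in auto)
      then show ?thesis using int_eq[OF x] by (simp add: integral_unique)
    qed
    moreover have "integrable (lebesgue_on {0..1}) v" using int[of 1] by simp
    ultimately show "abs_cont_deriv u v" unfolding abs_cont_deriv_def by blast
  qed
qed

lemma abs_cont_deriv_AE_cong:
  assumes uf: "abs_cont_deriv u f" and g: "integrable (lebesgue_on {0..1}) g"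
    and ae: "AE x in lebesgue_on {0..1}. f x = g x"
  shows "abs_cont_deriv u g"
proof -
  have "integral\<^sup>L (lebesgue_on {0..x}) f = integral\<^sup>L (lebesgue_on {0..x}) g" if x: "x \<in> {0..1}" for x
  proof (rule integral_cong_AE)
    have sub: "{0..x} \<subseteq> {0..1}" using x by auto
    show "f \<in> borel_measurable (lebesgue_on {0..x})" "g \<in> borel_measurable (lebesgue_on {0..x})"
      using abs_cont_derivD(1)[OF uf] g integrable_subinterval[OF _ sub] by blast+
    have "AE y in lebesgue. y \<in> {0..1} \<longrightarrow> f y = g y"
      using ae by (subst (asm) AE_restrict_space_iff) auto
    then have "AE y in lebesgue. y \<in> {0..x} \<longrightarrow> f y = g y"
      by (rule eventually_mono) (use sub in auto)
    then show "AE y in lebesgue_on {0..x}. f y = g y"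
      by (subst AE_restrict_space_iff) auto
  qed
  then show ?thesis using uf g unfolding abs_cont_deriv_def by metis
qed

text \<open>The equation \<open>u'''' = \<mu> u\<close> as a classical first-order system, with one-sided derivatives at the ends.\<close>

definition clamped_mode ::
  "real \<Rightarrow> (real \<Rightarrow> real) \<Rightarrow> (real \<Rightarrow> real) \<Rightarrow> (real \<Rightarrow> real) \<Rightarrow> (real \<Rightarrow> real) \<Rightarrow> bool" where
  "clamped_mode \<mu> u u1 u2 u3 \<longleftrightarrow>
     (\<forall>x\<in>{0..1}. (u has_real_derivative u1 x) (at x within {0..1}) \<and>
        (u1 has_real_derivative u2 x) (at x within {0..1}) \<and>
        (u2 has_real_derivative u3 x) (at x within {0..1}) \<and>
        (u3 has_real_derivative \<mu> * u x) (at x within {0..1}))"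

lemma clamped_modeD:
  assumes "clamped_mode \<mu> u u1 u2 u3" "x \<in> {0..1}"
  shows "(u has_real_derivative u1 x) (at x within {0..1})"
    "(u1 has_real_derivative u2 x) (at x within {0..1})"
    "(u2 has_real_derivative u3 x) (at x within {0..1})"
    "(u3 has_real_derivative \<mu> * u x) (at x within {0..1})"
  using assms unfolding clamped_mode_def by blast+

lemma clamped_mode_continuous:
  assumes "clamped_mode \<mu> u u1 u2 u3"
  shows "continuous_on {0..1} u" "continuous_on {0..1} u1"
    "continuous_on {0..1} u2" "continuous_on {0..1} u3"
  using assms by (auto simp: clamped_mode_def intro!: DERIV_continuous_on)

lemma clamped_mode_DERIV:
  assumes "clamped_mode \<mu> u u1 u2 u3" "0 < x" "x < 1"
  shows "(u has_real_derivative u1 x) (at x)" "(u1 has_real_derivative u2 x) (at x)"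
    "(u2 has_real_derivative u3 x) (at x)" "(u3 has_real_derivative \<mu> * u x) (at x)"
proof -
  have "x \<in> {0..1}" "at x within {0..1} = at x" using assms by (auto simp: at_within_Icc_at)
  then show "(u has_real_derivative u1 x) (at x)" "(u1 has_real_derivative u2 x) (at x)"
    "(u2 has_real_derivative u3 x) (at x)" "(u3 has_real_derivative \<mu> * u x) (at x)"
    using assms(1) unfolding clamped_mode_def by metis+
qed

text \<open>In the eigenvalue equation the fourth derivative agrees almost everywhere with the continuous function \<open>\<mu> u\<close>,
which may replace it in the integral representation of the third derivative.\<close>

lemma biharmonic_eigenfunction_iff:
  "(\<exists>f. biharmonic u f \<and> (AE x in lebesgue_on {0..1}. f x = \<mu> * u x)) \<longleftrightarrow>
   (\<exists>u1 u2 u3. clamped_mode \<mu> u u1 u2 u3 \<and> u 0 = 0 \<and> u1 0 = 0 \<and> u 1 = 0 \<and> u1 1 = 0)"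
  (is "?L \<longleftrightarrow> ?R")
proof
  assume ?L
  then obtain f u1 u2 u3 where ac: "abs_cont_deriv u u1" "abs_cont_deriv u1 u2"
      "abs_cont_deriv u2 u3" "abs_cont_deriv u3 f"
    and bc: "u 0 = 0" "u1 0 = 0" "u 1 = 0" "u1 1 = 0"
    and ae: "AE x in lebesgue_on {0..1}. f x = \<mu> * u x"
    unfolding biharmonic_def by blast
  note cont = ac[THEN abs_cont_deriv_continuous]
  have contu: "continuous_on {0..1} (\<lambda>x. \<mu> * u x)" by (intro continuous_intros cont)
  have "abs_cont_deriv u3 (\<lambda>x. \<mu> * u x)"
    using ae by (intro abs_cont_deriv_AE_cong[OF ac(4)] continuous_imp_integrable_real contu)
  then have "clamped_mode \<mu> u u1 u2 u3"
    using ac cont contu by (auto simp: clamped_mode_def abs_cont_deriv_iff_DERIV)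
  with bc show ?R by blast
next
  assume ?R
  then obtain u1 u2 u3 where m: "clamped_mode \<mu> u u1 u2 u3"
    and bc: "u 0 = 0" "u1 0 = 0" "u 1 = 0" "u1 1 = 0" by blast
  note cont = clamped_mode_continuous[OF m]
  have contu: "continuous_on {0..1} (\<lambda>x. \<mu> * u x)" by (intro continuous_intros cont)
  have "abs_cont_deriv u u1" "abs_cont_deriv u1 u2" "abs_cont_deriv u2 u3"
    "abs_cont_deriv u3 (\<lambda>x. \<mu> * u x)"
    using m cont contu by (auto simp: clamped_mode_def abs_cont_deriv_iff_DERIV)
  moreover have "(\<lambda>x. \<mu> * u x) \<in> L2_unit"
  proof -
    have "integrable (lebesgue_on {0..1}) (\<lambda>x. \<mu> * u x)"
      by (intro continuous_imp_integrable_real contu)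
    moreover have "integrable (lebesgue_on {0..1}) (\<lambda>x. (\<mu> * u x)\<^sup>2)"
      by (intro continuous_imp_integrable_real continuous_intros cont)
    ultimately show ?thesis by (auto simp: L2_unit_def)
  qed
  ultimately have "biharmonic u (\<lambda>x. \<mu> * u x)"
    using bc unfolding biharmonic_def by blast
  then show ?L by (intro exI[of _ "\<lambda>x. \<mu> * u x"]) auto
qed

text \<open>Gronwall's argument: the energy \<open>u\<^sup>2 + u1\<^sup>2 + u2\<^sup>2 + u3\<^sup>2\<close> grows at most at the exponential rate
\<open>2 + |\<mu>|\<close>, so it stays zero if it starts at zero.\<close>

lemma clamped_mode_unique:
  assumes m: "clamped_mode \<mu> u u1 u2 u3"
    and init: "u 0 = 0" "u1 0 = 0" "u2 0 = 0" "u3 0 = 0" and x: "x \<in> {0..1}"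
  shows "u x = 0"
proof -
  define E where "E = (\<lambda>x. exp (- (2 + \<bar>\<mu>\<bar>) * x) * ((u x)\<^sup>2 + (u1 x)\<^sup>2 + (u2 x)\<^sup>2 + (u3 x)\<^sup>2))"
  have "E x \<le> E 0"
  proof (rule DERIV_nonpos_imp_decreasing_open[where f = E])
    fix y assume y: "0 < y" "y < x"
    define a b c d where "a = u y" and "b = u1 y" and "c = u2 y" and "d = u3 y"
    let ?D = "exp (- (2 + \<bar>\<mu>\<bar>) * y) *
      (2 * (a * b + b * c + c * d + \<mu> * (d * a)) - (2 + \<bar>\<mu>\<bar>) * (a\<^sup>2 + b\<^sup>2 + c\<^sup>2 + d\<^sup>2))"
    have "(E has_real_derivative ?D) (at y)"
      unfolding E_def using clamped_mode_DERIV[OF m, of y] y x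
      by (auto intro!: derivative_eq_intros simp: a_def b_def c_def d_def algebra_simps power2_eq_square)
    moreover have "?D \<le> 0"
    proof -
      have p: "2 * (r * s) \<le> r\<^sup>2 + s\<^sup>2" for r s :: real
        using sum_squares_bound[of r s] by simp
      have "2 * \<bar>d * a\<bar> \<le> d\<^sup>2 + a\<^sup>2" using p[of "\<bar>d\<bar>" "\<bar>a\<bar>"] by (simp add: abs_mult)
      then have "\<bar>\<mu>\<bar> * (2 * \<bar>d * a\<bar>) \<le> \<bar>\<mu>\<bar> * (d\<^sup>2 + a\<^sup>2)" by (intro mult_left_mono) auto
      moreover have "\<mu> * (d * a) \<le> \<bar>\<mu>\<bar> * \<bar>d * a\<bar>" by (metis abs_ge_self abs_mult)
      ultimately have "2 * (\<mu> * (d * a)) \<le> \<bar>\<mu>\<bar> * (d\<^sup>2 + a\<^sup>2)" by linarith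
      moreover have "\<bar>\<mu>\<bar> * (d\<^sup>2 + a\<^sup>2) \<le> \<bar>\<mu>\<bar> * (a\<^sup>2 + b\<^sup>2 + c\<^sup>2 + d\<^sup>2)" by (intro mult_left_mono) auto
      moreover have "2 * (a * b + b * c + c * d) \<le> 2 * (a\<^sup>2 + b\<^sup>2 + c\<^sup>2 + d\<^sup>2)"
        using p[of a b] p[of b c] p[of c d] zero_le_power2[of a] zero_le_power2[of d] by argo
      ultimately have "2 * (a * b + b * c + c * d + \<mu> * (d * a)) \<le> (2 + \<bar>\<mu>\<bar>) * (a\<^sup>2 + b\<^sup>2 + c\<^sup>2 + d\<^sup>2)"
        by argo
      then show ?thesis by (simp add: mult_nonneg_nonpos)
    qed
    ultimately show "\<exists>D. (E has_real_derivative D) (at y) \<and> D \<le> 0" by blast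
  next
    have "continuous_on {0..1} E"
      unfolding E_def by (intro continuous_intros clamped_mode_continuous[OF m])
    then show "continuous_on {0..x} E" by (rule continuous_on_subset) (use x in auto)
  qed (use x in auto)
  also have "E 0 = 0" using init by (simp add: E_def)
  finally have "(u x)\<^sup>2 + (u1 x)\<^sup>2 + (u2 x)\<^sup>2 + (u3 x)\<^sup>2 \<le> 0"
    by (simp add: E_def mult_le_0_iff not_le)
  then have "(u x)\<^sup>2 \<le> 0"
    using zero_le_power2[of "u1 x"] zero_le_power2[of "u2 x"] zero_le_power2[of "u3 x"] by linarith
  then show ?thesis by simp
qed

text \<open>Integration by parts gives \<open>\<mu> \<integral>u\<^sup>2 = \<integral>u''\<^sup>2\<close>. In differential form, \<open>u''' u - u'' u'\<close> vanishes at both ends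
and has derivative \<open>\<mu> u\<^sup>2 - u''\<^sup>2\<close>; if \<open>\<mu> \<le> 0\<close> it is monotone, hence constant, so \<open>u'' = 0\<close>.\<close>

lemma clamped_mode_eigenvalue_pos:
  assumes m: "clamped_mode \<mu> u u1 u2 u3"
    and bc: "u 0 = 0" "u1 0 = 0" "u 1 = 0" "u1 1 = 0"
    and nz: "\<exists>x\<in>{0..1}. u x \<noteq> 0"
  shows "\<mu> > 0"
proof (rule ccontr)
  assume "\<not> \<mu> > 0"
  then have mu: "\<mu> \<le> 0" by simp
  define g where "g = (\<lambda>x. u3 x * u x - u2 x * u1 x)"
  note cont = clamped_mode_continuous[OF m]
  have contg: "continuous_on {0..1} g" unfolding g_def by (intro continuous_intros cont)
  have g0: "g 0 = 0" "g 1 = 0" using bc by (auto simp: g_def)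
  have D: "(g has_real_derivative \<mu> * (u x)\<^sup>2 - (u2 x)\<^sup>2) (at x)" if "0 < x" "x < 1" for x
    unfolding g_def using clamped_mode_DERIV[OF m, of x] that
    by (auto intro!: derivative_eq_intros simp: power2_eq_square)
  have D_le: "\<mu> * (u x)\<^sup>2 - (u2 x)\<^sup>2 \<le> 0" for x
    using mult_nonpos_nonneg[OF mu zero_le_power2[of "u x"]] zero_le_power2[of "u2 x"] by linarith
  have mono: "g y \<le> g x" if "0 \<le> x" "x \<le> y" "y \<le> 1" for x y
  proof (rule DERIV_nonpos_imp_decreasing_open[OF that(2)])
    fix z assume "x < z" "z < y"
    then have "0 < z" "z < 1" using that by auto
    with D D_le show "\<exists>d. (g has_real_derivative d) (at z) \<and> d \<le> 0" by blast
  next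
    show "continuous_on {x..y} g" by (rule continuous_on_subset[OF contg]) (use that in auto)
  qed
  have gz: "g x = 0" if "0 \<le> x" "x \<le> 1" for x
    using mono[of 0 x] mono[of x 1] g0 that by auto
  have u2: "u2 x = 0" if x: "0 < x" "x < 1" for x
  proof -
    have "((\<lambda>_. 0) has_real_derivative \<mu> * (u x)\<^sup>2 - (u2 x)\<^sup>2) (at x)"
      by (rule has_field_derivative_transform_within_open[OF D[OF x], of "{0<..<1}"])
         (use x gz in auto)
    then have "\<mu> * (u x)\<^sup>2 - (u2 x)\<^sup>2 = 0" using DERIV_unique DERIV_const by blast
    moreover have "\<mu> * (u x)\<^sup>2 \<le> 0" using mu by (simp add: mult_nonpos_nonneg)
    ultimately have "(u2 x)\<^sup>2 \<le> 0" by linarith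
    then show ?thesis by simp
  qed
  have u1: "u1 x = 0" if "0 \<le> x" "x \<le> 1" for x
    using DERIV_isconst2[OF _ cont(2) _ that] clamped_mode_DERIV(2)[OF m] u2 bc
    by (metis zero_less_one)
  have "u x = 0" if "0 \<le> x" "x \<le> 1" for x
    using DERIV_isconst2[OF _ cont(1) _ that] clamped_mode_DERIV(1)[OF m] u1 bc
    by (metis less_imp_le zero_less_one)
  with nz show False by auto
qed

text \<open>For \<open>w > 0\<close>, the general solution of \<open>u'''' = w\<^sup>4 u\<close> with \<open>u 0 = u' 0 = 0\<close>.\<close>

definition clamped_beam :: "real \<Rightarrow> real \<Rightarrow> real \<Rightarrow> real \<Rightarrow> real" where
  "clamped_beam w A B x = A * (cosh (w * x) - cos (w * x)) + B * (sinh (w * x) - sin (w * x))"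

lemma clamped_mode_clamped_beam:
  "clamped_mode (w ^ 4) (clamped_beam w A B)
     (\<lambda>x. w * (A * (sinh (w * x) + sin (w * x)) + B * (cosh (w * x) - cos (w * x))))
     (\<lambda>x. w ^ 2 * (A * (cosh (w * x) + cos (w * x)) + B * (sinh (w * x) + sin (w * x))))
     (\<lambda>x. w ^ 3 * (A * (sinh (w * x) - sin (w * x)) + B * (cosh (w * x) + cos (w * x))))"
  unfolding clamped_mode_def clamped_beam_def
  by (auto intro!: derivative_eq_intros simp: algebra_simps eval_nat_numeral)

lemma DERIV_unique_unit_interval:
  fixes u :: "real \<Rightarrow> real"
  assumes "(u has_real_derivative a) (at x within {0..1})" "(v has_real_derivative b) (at x within {0..1})"
    and "x \<in> {0..1}" and "\<And>y. y \<in> {0..1} \<Longrightarrow> u y = v y"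
  shows "a = b"
proof -
  have "(v has_vector_derivative a) (at x within {0..1})"
    using assms by (intro has_vector_derivative_transform[of x "{0..1}" v u])
      (auto simp: has_real_derivative_iff_has_vector_derivative)
  then show ?thesis
    using vector_derivative_unique_within_closed_interval[of 0 1 x v a b] assms
    by (auto simp: has_real_derivative_iff_has_vector_derivative)
qed

lemma clamped_mode_zero:
  assumes m: "clamped_mode \<mu> u u1 u2 u3" and z: "\<And>x. x \<in> {0..1} \<Longrightarrow> u x = 0"
    and x: "x \<in> {0..1}"
  shows "u3 x = 0"
proof -
  have *: "v' y = 0" if "\<And>y. y \<in> {0..1} \<Longrightarrow> v y = 0"
      "\<And>y. y \<in> {0..1} \<Longrightarrow> (v has_real_derivative v' y) (at y within {0..1})" "y \<in> {0..1}"
    for v v' :: "real \<Rightarrow> real" and y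
    by (rule DERIV_unique_unit_interval[OF that(2)[OF that(3)] DERIV_const that(3)]) (rule that(1))
  have "u1 y = 0" if "y \<in> {0..1}" for y
    using *[OF z clamped_modeD(1)[OF m] that] .
  then have "u2 y = 0" if "y \<in> {0..1}" for y
    using *[OF _ clamped_modeD(2)[OF m] that] by blast
  then show ?thesis
    using *[OF _ clamped_modeD(3)[OF m] x] by blast
qed

lemma continuous_AE_zero_imp_zero:
  fixes u :: "real \<Rightarrow> real"
  assumes cont: "continuous_on {0..1} u" and ae: "AE x in lebesgue_on {0..1}. u x = 0"
    and x: "x \<in> {0..1}"
  shows "u x = 0"
proof -
  have cont2: "continuous_on {0..1} (\<lambda>x. (u x)\<^sup>2)" by (intro continuous_intros cont)
  have "integral\<^sup>L (lebesgue_on {0..1}) (\<lambda>x. (u x)\<^sup>2) = 0"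
    by (rule integral_eq_zero_AE) (use ae in auto)
  then have "integral {0..1} (\<lambda>x. (u x)\<^sup>2) = 0"
    by (subst (asm) lebesgue_integral_eq_integral) (auto intro: continuous_imp_integrable_real cont2)
  then show ?thesis
    using integral_eq_0_iff[of 0 1 "\<lambda>x. (u x)\<^sup>2"] cont2 x by auto
qed

text \<open>The conditions \<open>u 1 = u' 1 = 0\<close> are two linear equations for the coefficients \<open>A\<close>, \<open>B\<close>
of \<open>clamped_beam\<close>, and their determinant is \<open>- 2\<close> times the characteristic function.\<close>

lemma biharmonic_spectrum_eq:
  "biharmonic_spectrum = {w ^ 4 | w. w > 0 \<and> clamped_char w = 0}"
proof (intro equalityI subsetI)
  fix \<mu> assume "\<mu> \<in> biharmonic_spectrum"
  then obtain u f where "biharmonic u f" "AE x in lebesgue_on {0..1}. f x = \<mu> * u x"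
    and nz: "\<not> (AE x in lebesgue_on {0..1}. u x = 0)"
    unfolding biharmonic_spectrum_def by blast
  then obtain u1 u2 u3 where m: "clamped_mode \<mu> u u1 u2 u3"
    and bc: "u 0 = 0" "u1 0 = 0" "u 1 = 0" "u1 1 = 0"
    using biharmonic_eigenfunction_iff[of u \<mu>] by blast
  have nz': "\<exists>x\<in>{0..1}. u x \<noteq> 0"
    using nz by (auto intro: AE_I2)
  have mu: "\<mu> > 0" by (rule clamped_mode_eigenvalue_pos[OF m bc nz'])
  define w where "w = root 4 \<mu>"
  have w: "w > 0" "w ^ 4 = \<mu>" using mu by (auto simp: w_def)
  \<comment> \<open>These coefficients match the second and third derivatives of \<open>u\<close> at \<open>0\<close>.\<close>
  define A B where "A = u2 0 / (2 * w ^ 2)" and "B = u3 0 / (2 * w ^ 3)"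
  let ?v1 = "\<lambda>x. w * (A * (sinh (w * x) + sin (w * x)) + B * (cosh (w * x) - cos (w * x)))"
  let ?v2 = "\<lambda>x. w ^ 2 * (A * (cosh (w * x) + cos (w * x)) + B * (sinh (w * x) + sin (w * x)))"
  let ?v3 = "\<lambda>x. w ^ 3 * (A * (sinh (w * x) - sin (w * x)) + B * (cosh (w * x) + cos (w * x)))"
  have diff: "clamped_mode \<mu> (\<lambda>x. u x - clamped_beam w A B x) (\<lambda>x. u1 x - ?v1 x)
      (\<lambda>x. u2 x - ?v2 x) (\<lambda>x. u3 x - ?v3 x)"
    using m clamped_mode_clamped_beam[of w A B] unfolding w(2) clamped_mode_def right_diff_distrib
    by (intro ballI conjI DERIV_diff) blast+
  have u_eq: "u x = clamped_beam w A B x" if "x \<in> {0..1}" for x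
    using clamped_mode_unique[OF diff _ _ _ _ that] bc w
    by (auto simp: clamped_beam_def A_def B_def)
  have "A \<noteq> 0 \<or> B \<noteq> 0"
  proof (rule ccontr)
    assume "\<not> (A \<noteq> 0 \<or> B \<noteq> 0)"
    then have "u x = 0" if "x \<in> {0..1}" for x using u_eq[OF that] by (simp add: clamped_beam_def)
    with nz' show False by blast
  qed
  moreover have "A * (cosh w - cos w) + B * (sinh w - sin w) = 0"
    using u_eq[of 1] bc by (simp add: clamped_beam_def)
  moreover have "A * (sinh w + sin w) + B * (cosh w - cos w) = 0"
  proof -
    have "(clamped_beam w A B has_real_derivative ?v1 1) (at 1 within {0..1})"
      by (rule clamped_modeD(1)[OF clamped_mode_clamped_beam]) simp
    moreover have "(u has_real_derivative u1 1) (at 1 within {0..1})"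
      by (rule clamped_modeD(1)[OF m]) simp
    ultimately have "?v1 1 = u1 1"
      by (rule DERIV_unique_unit_interval) (use u_eq in auto)
    then show ?thesis using bc w by simp
  qed
  ultimately have "(cosh w - cos w)\<^sup>2 - (sinh w - sin w) * (sinh w + sin w) = 0"
    by algebra
  moreover have "(cosh w - cos w)\<^sup>2 - (sinh w - sin w) * (sinh w + sin w) = - 2 * clamped_char w"
    using cosh_square_eq[of w] sin_squared_eq[of w] unfolding clamped_char_def by algebra
  ultimately have "clamped_char w = 0" by simp
  with w show "\<mu> \<in> {w ^ 4 | w. w > 0 \<and> clamped_char w = 0}" by auto
next
  fix \<mu> assume "\<mu> \<in> {w ^ 4 | w. w > 0 \<and> clamped_char w = 0}"
  then obtain w where w: "w > 0" "clamped_char w = 0" and mu: "\<mu> = w ^ 4" by blast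
  \<comment> \<open>This choice solves the condition \<open>u 1 = 0\<close>; the condition \<open>u' 1 = 0\<close> is then the characteristic equation.\<close>
  define A B where "A = sinh w - sin w" and "B = - (cosh w - cos w)"
  have char: "A * (sinh w + sin w) + B * (cosh w - cos w) = 2 * clamped_char w"
    using cosh_square_eq[of w] sin_squared_eq[of w] unfolding clamped_char_def A_def B_def by algebra
  let ?u = "clamped_beam w A B"
  have m: "\<exists>u1 u2 u3. clamped_mode \<mu> ?u u1 u2 u3 \<and> ?u 0 = 0 \<and> u1 0 = 0 \<and> ?u 1 = 0 \<and> u1 1 = 0"
    unfolding mu
  proof (intro exI conjI)
    show "clamped_mode (w ^ 4) ?u
       (\<lambda>x. w * (A * (sinh (w * x) + sin (w * x)) + B * (cosh (w * x) - cos (w * x))))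
       (\<lambda>x. w ^ 2 * (A * (cosh (w * x) + cos (w * x)) + B * (sinh (w * x) + sin (w * x))))
       (\<lambda>x. w ^ 3 * (A * (sinh (w * x) - sin (w * x)) + B * (cosh (w * x) + cos (w * x))))"
      by (rule clamped_mode_clamped_beam)
    show "?u 1 = 0" by (simp add: clamped_beam_def A_def B_def algebra_simps)
    show "w * (A * (sinh (w * 1) + sin (w * 1)) + B * (cosh (w * 1) - cos (w * 1))) = 0"
      using char w by simp
  qed (simp_all add: clamped_beam_def)
  then obtain f where f: "biharmonic ?u f" "AE x in lebesgue_on {0..1}. f x = \<mu> * ?u x"
    using biharmonic_eigenfunction_iff[of ?u \<mu>] by blast
  have "\<not> (AE x in lebesgue_on {0..1}. ?u x = 0)"
  proof
    assume ae: "AE x in lebesgue_on {0..1}. ?u x = 0"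
    note m' = clamped_mode_clamped_beam[of w A B]
    have "?u x = 0" if "x \<in> {0..1}" for x
      using continuous_AE_zero_imp_zero[OF clamped_mode_continuous(1)[OF m'] ae that] .
    then have "B * w ^ 3 = 0"
      using clamped_mode_zero[OF m', of 0] by auto
    then show False using w cosh_gt_one[of w] cos_le_one[of w] unfolding B_def by simp
  qed
  with f show "\<mu> \<in> biharmonic_spectrum"
    unfolding biharmonic_spectrum_def by blast
qed

lemma strict_mono_range_unique:
  fixes f g :: "nat \<Rightarrow> 'a :: linorder"
  assumes f: "strict_mono f" and g: "strict_mono g" and eq: "range f = range g"
  shows "f = g"
proof
  fix n
  have le: "g n \<le> f n" if f: "strict_mono f" and g: "strict_mono g" and eq: "range f = range g"
    and IH: "\<And>m. m < n \<Longrightarrow> f m = g m" for f g :: "nat \<Rightarrow> 'a" and n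
  proof -
    obtain m where m: "f n = g m" using eq by (metis rangeE rangeI)
    have "n \<le> m"
      using IH[of m] m strict_mono_eq[OF f, of n m] by (cases "m < n") auto
    then show ?thesis using m g by (simp add: strict_mono_less_eq)
  qed
  show "f n = g n"
  proof (induction n rule: less_induct)
    case (less n)
    then show ?case using le[OF f g eq, of n] le[OF g f eq[symmetric], of n] by fastforce
  qed
qed

lemma biharmonic_eigenvalue_eq:
  assumes k: "k \<ge> 1"
  shows "biharmonic_eigenvalue k = clamped_root k ^ 4"
proof -
  define lam where "lam = (\<lambda>i. clamped_root (Suc i) ^ 4)"
  have "strict_mono lam"
    unfolding strict_mono_Suc_iff
  proof
    fix n
    show "lam n < lam (Suc n)"
      unfolding lam_def using clamped_root_less_Suc[of "Suc n"] clamped_root_pos[of "Suc n"]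
      by (intro power_strict_mono) auto
  qed
  moreover have "range lam = biharmonic_spectrum"
    unfolding biharmonic_spectrum_eq
  proof (intro equalityI subsetI)
    fix x assume "x \<in> range lam"
    then obtain i where "x = clamped_root (Suc i) ^ 4" by (auto simp: lam_def)
    then show "x \<in> {w ^ 4 |w. w > 0 \<and> clamped_char w = 0}"
      using clamped_root_pos[of "Suc i"] clamped_root(2)[of "Suc i"] by auto
  next
    fix x assume "x \<in> {w ^ 4 |w. w > 0 \<and> clamped_char w = 0}"
    then obtain w where w: "x = w ^ 4" "w > 0" "clamped_char w = 0" by blast
    obtain j where "j \<ge> 1" "w = clamped_root j" using clamped_char_zeros[OF w(2,3)] by blast
    then have "x = lam (j - 1)" using w by (simp add: lam_def)
    then show "x \<in> range lam" by blast
  qed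
  ultimately have *: "strict_mono lam \<and> range lam = biharmonic_spectrum" by blast
  have "(THE lam. strict_mono lam \<and> range lam = biharmonic_spectrum) = lam"
  proof (rule the_equality)
    show "strict_mono lam \<and> range lam = biharmonic_spectrum" by (rule *)
  next
    fix g :: "nat \<Rightarrow> real" assume "strict_mono g \<and> range g = biharmonic_spectrum"
    with * show "g = lam" by (intro strict_mono_range_unique) simp_all
  qed
  then show ?thesis using k by (simp add: biharmonic_eigenvalue_def lam_def)
qed

section \<open>The discrete spectrum from a complete system of eigenvectors\<close>

text \<open>The system defining the Hermitian derivative is diagonally dominant: at an index where the difference
of two solutions is largest, \<open>4 |d m| \<le> |d (m - 1)| + |d (m + 1)| \<le> 2 |d m|\<close>.\<close>

lemma hermitian_deriv_eqI:
  assumes p: "p \<in> grid0 N"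
    and eq: "\<And>j. j \<in> {1..N - 1} \<Longrightarrow> 1/6 * p (j - 1) + 2/3 * p j + 1/6 * p (j + 1) = delta_x N u j"
  shows "hermitian_deriv N u = p"
  unfolding hermitian_deriv_def
proof (rule the_equality)
  fix q assume q: "q \<in> grid0 N \<and>
    (\<forall>j\<in>{1..N - 1}. 1/6 * q (j - 1) + 2/3 * q j + 1/6 * q (j + 1) = delta_x N u j)"
  define d where "d = (\<lambda>j. \<bar>q j - p j\<bar>)"
  obtain m where m: "m \<in> {..N}" "\<And>j. j \<in> {..N} \<Longrightarrow> d j \<le> d m"
  proof -
    have "Max (d ` {..N}) \<in> d ` {..N}" by (intro Max_in) auto
    then obtain m where m: "Max (d ` {..N}) = d m" "m \<in> {..N}" by (rule imageE)
    show ?thesis by (rule that[OF m(2)]) (simp flip: m(1))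
  qed
  have "d m = 0"
  proof (cases "m \<in> {1..N - 1}")
    case True
    then have N: "m - 1 \<in> {..N}" "m + 1 \<in> {..N}" by auto
    have "4 * (q m - p m) = - (q (m - 1) - p (m - 1)) - (q (m + 1) - p (m + 1))"
      using q eq True by (force simp: field_simps)
    then have "4 * d m \<le> d (m - 1) + d (m + 1)" unfolding d_def by linarith
    moreover have "d m \<ge> 0" by (simp add: d_def)
    ultimately show ?thesis using m(2)[OF N(1)] m(2)[OF N(2)] by linarith
  next
    case False
    then have "m = 0 \<or> m \<ge> N" by auto
    then show ?thesis using p q by (auto simp: grid0_def d_def)
  qed
  then have "d j = 0" if "j \<le> N" for j using m(2)[of j] that by (auto simp: d_def)
  then show "q = p" using p q unfolding grid0_def d_def
    by (intro ext) (metis (mono_tags, lifting) abs_eq_0 eq_iff_diff_eq_0 mem_Collect_eq nle_le)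
qed (use assms in auto)

lemma delta_x_sum: "delta_x N (\<lambda>j. \<Sum>i\<in>I. c i * v i j) = (\<lambda>j. \<Sum>i\<in>I. c i * delta_x N (v i) j)"
  by (auto simp: delta_x_def fun_eq_iff sum_subtractf sum_divide_distrib algebra_simps diff_divide_distrib)

lemma delta_x2_sum: "delta_x2 N (\<lambda>j. \<Sum>i\<in>I. c i * v i j) = (\<lambda>j. \<Sum>i\<in>I. c i * delta_x2 N (v i) j)"
  by (auto simp: delta_x2_def fun_eq_iff sum_subtractf sum.distrib sum_distrib_left sum_divide_distrib
      algebra_simps diff_divide_distrib add_divide_distrib)

text \<open>An eigenvector together with a witness for its Hermitian derivative. Since
\<open>hermitian_deriv\<close> is a definite description, carrying the witness makes the operator provably linear on
combinations of eigenvectors, and these turn out to span all grid functions.\<close>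

definition discrete_mode :: "nat \<Rightarrow> real \<Rightarrow> (nat \<Rightarrow> real) \<Rightarrow> bool" where
  "discrete_mode N \<mu> v \<longleftrightarrow> v \<in> grid0 N \<and> (\<exists>p\<in>grid0 N.
     (\<forall>j\<in>{1..N - 1}. 1/6 * p (j - 1) + 2/3 * p j + 1/6 * p (j + 1) = delta_x N v j) \<and>
     (\<forall>j. 12 / (mesh N)\<^sup>2 * (delta_x N p j - delta_x2 N v j) = \<mu> * v j))"

lemma delta_x4_sum_modes:
  assumes "\<And>i. i \<in> I \<Longrightarrow> discrete_mode N (\<mu> i) (v i)"
  shows "delta_x4 N (\<lambda>j. \<Sum>i\<in>I. c i * v i j) j = (\<Sum>i\<in>I. c i * (\<mu> i * v i j))"
proof -
  obtain p where p: "\<And>i. i \<in> I \<Longrightarrow> p i \<in> grid0 N"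
    "\<And>i j. i \<in> I \<Longrightarrow> j \<in> {1..N - 1} \<Longrightarrow>
       1/6 * p i (j - 1) + 2/3 * p i j + 1/6 * p i (j + 1) = delta_x N (v i) j"
    "\<And>i j. i \<in> I \<Longrightarrow> 12 / (mesh N)\<^sup>2 * (delta_x N (p i) j - delta_x2 N (v i) j) = \<mu> i * v i j"
    using assms unfolding discrete_mode_def by metis
  have "hermitian_deriv N (\<lambda>j. \<Sum>i\<in>I. c i * v i j) = (\<lambda>j. \<Sum>i\<in>I. c i * p i j)"
  proof (rule hermitian_deriv_eqI)
    show "(\<lambda>j. \<Sum>i\<in>I. c i * p i j) \<in> grid0 N" using p(1) by (auto simp: grid0_def)
    fix j assume j: "j \<in> {1..N - 1}"
    have "1/6 * (\<Sum>i\<in>I. c i * p i (j - 1)) + 2/3 * (\<Sum>i\<in>I. c i * p i j) + 1/6 * (\<Sum>i\<in>I. c i * p i (j + 1))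
      = (\<Sum>i\<in>I. c i * (1/6 * p i (j - 1) + 2/3 * p i j + 1/6 * p i (j + 1)))"
      by (simp add: sum_distrib_left sum.distrib algebra_simps)
    also have "\<dots> = delta_x N (\<lambda>j. \<Sum>i\<in>I. c i * v i j) j"
      unfolding delta_x_sum using p(2) j by (intro sum.cong refl) simp
    finally show "1/6 * (\<Sum>i\<in>I. c i * p i (j - 1)) + 2/3 * (\<Sum>i\<in>I. c i * p i j) + 1/6 * (\<Sum>i\<in>I. c i * p i (j + 1))
      = delta_x N (\<lambda>j. \<Sum>i\<in>I. c i * v i j) j" .
  qed
  then have "delta_x4 N (\<lambda>j. \<Sum>i\<in>I. c i * v i j) j =
     (\<Sum>i\<in>I. c i * (12 / (mesh N)\<^sup>2 * (delta_x N (p i) j - delta_x2 N (v i) j)))"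
    unfolding delta_x4_def
    by (simp only: delta_x_sum delta_x2_sum flip: sum_subtractf)
       (auto simp: sum_distrib_left right_diff_distrib mult.left_commute intro!: sum.cong)
  also have "\<dots> = (\<Sum>i\<in>I. c i * (\<mu> i * v i j))"
    by (intro sum.cong refl) (simp only: p(3))
  finally show ?thesis .
qed

text \<open>If \<open>\<Sum> c\<^sub>i v\<^sub>i = 0\<close>, applying the operators \<open>\<delta>\<^sub>x\<^sup>4 - \<mu>\<^sub>m\<close> for all \<open>m \<noteq> i\<close> leaves only the \<open>i\<close>-th term.\<close>

lemma modes_independent:
  assumes fin: "finite I" and inj: "inj_on \<mu> I"
    and mode: "\<And>i. i \<in> I \<Longrightarrow> discrete_mode N (\<mu> i) (v i)"
    and nz: "\<And>i. i \<in> I \<Longrightarrow> \<exists>j. v i j \<noteq> 0"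
    and zero: "\<And>j. (\<Sum>i\<in>I. c i * v i j) = 0" and i: "i \<in> I"
  shows "c i = 0"
proof -
  have step: "(\<Sum>i\<in>I. c i * (\<mu> i * v i j)) = 0"
    if "\<And>j. (\<Sum>i\<in>I. c i * v i j) = 0" for c j
  proof -
    note T = delta_x4_sum_modes[of I N \<mu> v, OF mode]
    have "(\<lambda>j. \<Sum>i\<in>I. c i * v i j) = (\<lambda>j. \<Sum>i\<in>I. 0 * v i j)" using that by simp
    then have "(\<Sum>i\<in>I. c i * (\<mu> i * v i j)) = (\<Sum>i\<in>I. 0 * (\<mu> i * v i j))"
      using T[of c j] T[of "\<lambda>_. 0" j] by simp
    then show ?thesis by simp
  qed
  have prods: "(\<Sum>i\<in>I. (c i * (\<Prod>m\<in>S. \<mu> i - \<mu> m)) * v i j) = 0" if "finite S" for S j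
    using that
  proof (induction S arbitrary: j rule: finite_induct)
    case empty
    then show ?case using zero by simp
  next
    case (insert a S)
    have "(\<Sum>i\<in>I. (c i * (\<Prod>m\<in>insert a S. \<mu> i - \<mu> m)) * v i j) =
       (\<Sum>i\<in>I. (c i * (\<Prod>m\<in>S. \<mu> i - \<mu> m)) * (\<mu> i * v i j)) -
       \<mu> a * (\<Sum>i\<in>I. (c i * (\<Prod>m\<in>S. \<mu> i - \<mu> m)) * v i j)"
      unfolding sum_distrib_left sum_subtractf[symmetric] prod.insert[OF insert.hyps]
      by (intro sum.cong refl) (simp add: algebra_simps)
    then show ?case unfolding step[OF insert.IH] insert.IH by simp
  qed
  have "(\<Sum>k\<in>I. (c k * (\<Prod>m\<in>I - {i}. \<mu> k - \<mu> m)) * v k j) = 0" for j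
    by (rule prods) (use fin in blast)
  moreover have "(\<Sum>k\<in>I. (c k * (\<Prod>m\<in>I - {i}. \<mu> k - \<mu> m)) * v k j) =
     c i * (\<Prod>m\<in>I - {i}. \<mu> i - \<mu> m) * v i j" for j
  proof -
    have "(\<Prod>m\<in>I - {i}. \<mu> k - \<mu> m) = 0" if "k \<in> I" "k \<noteq> i" for k
      using that fin by (auto intro!: prod_zero)
    then show ?thesis by (subst sum.remove[OF fin i]) (simp add: sum.neutral)
  qed
  ultimately have "c i * (\<Prod>m\<in>I - {i}. \<mu> i - \<mu> m) * v i j = 0" for j by simp
  moreover have "(\<Prod>m\<in>I - {i}. \<mu> i - \<mu> m) \<noteq> 0"
    using fin inj i by (auto simp: inj_on_def)
  ultimately show ?thesis using nz[OF i] by auto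
qed

text \<open>This is the vector space structure in terms of which \<open>discrete_multiplicity\<close> is defined.\<close>

interpretation grid_vs: vector_space "\<lambda>(c::real) (v::nat \<Rightarrow> real) j. c * v j"
  by unfold_locales (auto simp: fun_eq_iff algebra_simps)

lemma sum_fun_apply: "(\<Sum>i\<in>I. f i) x = (\<Sum>i\<in>I. f i x :: real)"
  by (induction I rule: infinite_finite_induct) auto

lemma card_independent_grid0:
  assumes N: "N \<ge> 1" and ind: "grid_vs.independent B" and sub: "B \<subseteq> grid0 N"
  shows "finite B \<and> card B \<le> N - 1"
proof -
  define e where "e = (\<lambda>i j::nat. if i = j then 1 else 0 :: real)"
  have "grid0 N \<subseteq> grid_vs.span (e ` {1..<N})"
  proof
    fix v assume v: "v \<in> grid0 N"
    have "v j = (\<Sum>i\<in>{1..<N}. v i * e i j)" for j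
    proof -
      have "(\<Sum>i\<in>{1..<N}. v i * e i j) = (\<Sum>i\<in>{1..<N}. if i = j then v i else 0)"
        by (intro sum.cong) (auto simp: e_def)
      also have "\<dots> = (if j \<in> {1..<N} then v j else 0)" by (simp add: sum.delta')
      also have "\<dots> = v j"
      proof (cases "j \<in> {1..<N}")
        case False
        then have "j = 0 \<or> j \<ge> N" by auto
        then have "v j = 0" using v unfolding grid0_def by blast
        with False show ?thesis by simp
      qed simp
      finally show ?thesis by simp
    qed
    then have "v = (\<Sum>i\<in>{1..<N}. (\<lambda>j. v i * e i j))"
      unfolding fun_eq_iff sum_fun_apply by blast
    also have "\<dots> \<in> grid_vs.span (e ` {1..<N})"
      by (intro grid_vs.span_sum grid_vs.span_scale grid_vs.span_base) auto
    finally show "v \<in> grid_vs.span (e ` {1..<N})" .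
  qed
  then have "finite B \<and> card B \<le> card (e ` {1..<N})"
    using sub by (intro grid_vs.independent_span_bound ind) auto
  moreover have "card (e ` {1..<N}) \<le> N - 1" using card_image_le[of "{1..<N}" e] by simp
  ultimately show ?thesis by simp
qed

text \<open>As many distinct eigenvalues as the dimension \<open>N - 1\<close> of \<open>grid0 N\<close>: the eigenvectors form a
basis, so these are all the eigenvalues and each is simple.\<close>

locale complete_modes =
  fixes N :: nat and \<mu> :: "nat \<Rightarrow> real" and v :: "nat \<Rightarrow> nat \<Rightarrow> real"
  assumes N: "N \<ge> 1"
    and eig_less: "\<And>i j. i \<in> {1..<N} \<Longrightarrow> j \<in> {1..<N} \<Longrightarrow> i < j \<Longrightarrow> \<mu> i < \<mu> j"
    and mode: "\<And>i. i \<in> {1..<N} \<Longrightarrow> discrete_mode N (\<mu> i) (v i)"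
    and nz: "\<And>i. i \<in> {1..<N} \<Longrightarrow> \<exists>j. v i j \<noteq> 0"
begin

lemma inj_eig: "inj_on \<mu> {1..<N}"
proof (rule inj_onI, rule ccontr)
  fix i j assume "i \<in> {1..<N}" "j \<in> {1..<N}" "\<mu> i = \<mu> j" "i \<noteq> j"
  then show False using eig_less[of i j] eig_less[of j i] by (cases "i < j") auto
qed

lemma coeffs_zero:
  assumes "\<And>j. (\<Sum>i\<in>{1..<N}. c i * v i j) = 0" "i \<in> {1..<N}"
  shows "c i = 0"
proof (rule modes_independent[where \<mu> = \<mu> and N = N and v = v])
  show "inj_on \<mu> {1..<N}" by (rule inj_eig)
  show "discrete_mode N (\<mu> k) (v k)" if "k \<in> {1..<N}" for k by (rule mode) fact
  show "\<exists>j. v k j \<noteq> 0" if "k \<in> {1..<N}" for k by (rule nz) fact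
  show "(\<Sum>i\<in>{1..<N}. c i * v i j) = 0" for j by (rule assms(1))
  show "i \<in> {1..<N}" by (rule assms(2))
qed simp

lemma inj_v: "inj_on v {1..<N}"
proof (rule inj_onI, rule ccontr)
  fix i k assume ik: "i \<in> {1..<N}" "k \<in> {1..<N}" "v i = v k" "i \<noteq> k"
  define c where "c = (\<lambda>m. if m = i then 1 else if m = k then - 1 else (0::real))"
  have "(\<Sum>m\<in>{1..<N}. c m * v m j) = 0" for j
  proof -
    have "(\<Sum>m\<in>{1..<N}. c m * v m j) = (\<Sum>m\<in>{i, k}. c m * v m j)"
      using ik by (intro sum.mono_neutral_right) (auto simp: c_def)
    then show ?thesis using ik by (simp add: c_def)
  qed
  from coeffs_zero[of c i, OF this ik(1)] show False by (simp add: c_def)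
qed

lemma independent_modes: "grid_vs.independent (v ` {1..<N})"
proof (rule grid_vs.independent_if_scalars_zero)
  fix f x assume *: "(\<Sum>x\<in>v ` {1..<N}. (\<lambda>j. f x * x j)) = 0" and x: "x \<in> v ` {1..<N}"
  from * have "(\<Sum>i\<in>{1..<N}. (\<lambda>j. f (v i) * v i j)) = 0"
    unfolding sum.reindex[OF inj_v] o_def .
  then have "(\<Sum>i\<in>{1..<N}. f (v i) * v i j) = 0" for j
    using sum_fun_apply[of "\<lambda>i j. f (v i) * v i j" "{1..<N}" j] by simp
  from coeffs_zero[of "\<lambda>i. f (v i)", OF this] show "f x = 0" using x by auto
qed simp

lemma modes_span:
  assumes w: "w \<in> grid0 N"
  obtains c where "w = (\<lambda>j. \<Sum>i\<in>{1..<N}. c i * v i j)"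
proof -
  have sub: "v ` {1..<N} \<subseteq> grid0 N" using mode by (auto simp: discrete_mode_def)
  have "w \<in> grid_vs.span (v ` {1..<N})"
  proof (rule ccontr)
    assume nin: "w \<notin> grid_vs.span (v ` {1..<N})"
    then have "w \<notin> v ` {1..<N}" using grid_vs.span_base by blast
    then have "card (insert w (v ` {1..<N})) = Suc (N - 1)"
      using inj_v by (simp add: card_image)
    moreover have "card (insert w (v ` {1..<N})) \<le> N - 1"
      using card_independent_grid0[OF N grid_vs.independent_insertI[OF nin independent_modes]] w sub
      by simp
    ultimately show False by simp
  qed
  then obtain u where "w = (\<Sum>x\<in>v ` {1..<N}. (\<lambda>j. u x * x j))"
    by (auto simp: grid_vs.span_finite)
  also have "\<dots> = (\<Sum>i\<in>{1..<N}. (\<lambda>j. u (v i) * v i j))"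
    unfolding sum.reindex[OF inj_v] o_def ..
  also have "\<dots> = (\<lambda>j. \<Sum>i\<in>{1..<N}. u (v i) * v i j)"
    by (simp add: fun_eq_iff sum_fun_apply)
  finally show ?thesis by (rule that)
qed

text \<open>Comparing coefficients in \<open>\<delta>\<^sub>x\<^sup>4 w = \<nu> w\<close> with respect to the basis of eigenvectors.\<close>

lemma eigenspace_coeffs:
  assumes c: "(\<lambda>j. \<Sum>i\<in>{1..<N}. c i * v i j) \<in> discrete_eigenspace N \<nu>" and i: "i \<in> {1..<N}"
  shows "c i = 0 \<or> \<mu> i = \<nu>"
proof -
  have T: "delta_x4 N (\<lambda>j. \<Sum>i\<in>{1..<N}. c i * v i j) j = (\<Sum>i\<in>{1..<N}. c i * (\<mu> i * v i j))" for j
    by (rule delta_x4_sum_modes) (rule mode)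
  have "(\<Sum>i\<in>{1..<N}. (c i * (\<mu> i - \<nu>)) * v i j) = 0" for j
  proof -
    have "(\<Sum>i\<in>{1..<N}. c i * (\<mu> i * v i j)) = \<nu> * (\<Sum>i\<in>{1..<N}. c i * v i j)"
      using c unfolding discrete_eigenspace_def T[symmetric] by blast
    then show ?thesis by (simp add: sum_distrib_left algebra_simps sum_subtractf)
  qed
  from coeffs_zero[of "\<lambda>i. c i * (\<mu> i - \<nu>)", OF this i] show ?thesis by simp
qed

lemma mode_in_eigenspace:
  assumes i: "i \<in> {1..<N}" shows "v i \<in> discrete_eigenspace N (\<mu> i)"
proof -
  have "delta_x4 N (\<lambda>j. \<Sum>k\<in>{i}. 1 * v k j) j = (\<Sum>k\<in>{i}. 1 * (\<mu> k * v k j))" for j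
    by (rule delta_x4_sum_modes) (use i mode in auto)
  then have "delta_x4 N (v i) j = \<mu> i * v i j" for j by simp
  then show ?thesis using mode[OF i] by (auto simp: discrete_eigenspace_def discrete_mode_def)
qed

lemma discrete_multiplicity_eq:
  "discrete_multiplicity N \<nu> = (if \<nu> \<in> \<mu> ` {1..<N} then 1 else 0)"
proof -
  let ?E = "discrete_eigenspace N \<nu>"
  have E_grid: "?E \<subseteq> grid0 N" by (auto simp: discrete_eigenspace_def)
  show ?thesis
  proof (cases "\<nu> \<in> \<mu> ` {1..<N}")
    case True
    then obtain m where m: "m \<in> {1..<N}" "\<nu> = \<mu> m" by auto
    have "?E \<subseteq> grid_vs.span {v m}"
    proof
      fix w assume w: "w \<in> ?E"
      obtain c where c: "w = (\<lambda>j. \<Sum>i\<in>{1..<N}. c i * v i j)"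
        using modes_span E_grid w by blast
      have "c i = 0" if "i \<in> {1..<N}" "i \<noteq> m" for i
        using eigenspace_coeffs[of c \<nu> i] w c that m inj_eig by (auto simp: inj_on_def)
      then have "w = (\<lambda>j. c m * v m j)"
        unfolding c using m by (subst sum.remove[of _ m]) (auto simp: fun_eq_iff intro!: sum.neutral)
      then show "w \<in> grid_vs.span {v m}"
        using grid_vs.span_scale[OF grid_vs.span_base[of "v m" "{v m}"], of "c m"] by simp
    qed
    moreover have "{v m} \<subseteq> ?E" using mode_in_eigenspace m by auto
    ultimately have "grid_vs.span {v m} = grid_vs.span ?E"
      using grid_vs.span_superset[of ?E] by (auto simp: grid_vs.span_eq)
    moreover have "grid_vs.independent {v m}"
      using grid_vs.independent_mono[OF independent_modes, of "{v m}"] m by auto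
    ultimately have "grid_vs.dim ?E = card {v m}" by (rule grid_vs.dim_eq_card)
    then show ?thesis using True by (simp add: discrete_multiplicity_def)
  next
    case False
    have "?E \<subseteq> grid_vs.span {}"
    proof
      fix w assume w: "w \<in> ?E"
      obtain c where c: "w = (\<lambda>j. \<Sum>i\<in>{1..<N}. c i * v i j)"
        using modes_span E_grid w by blast
      have "c i = 0" if "i \<in> {1..<N}" for i
        using eigenspace_coeffs[of c \<nu> i] w c that False by auto
      then show "w \<in> grid_vs.span {}" unfolding c by (auto simp: fun_eq_iff)
    qed
    then have "grid_vs.span {} = grid_vs.span ?E"
      by (simp only: grid_vs.span_eq) simp
    then have "grid_vs.dim ?E = card ({} :: (nat \<Rightarrow> real) set)"
      by (rule grid_vs.dim_eq_card) (rule grid_vs.independent_empty)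
    then show ?thesis using False by (simp add: discrete_multiplicity_def)
  qed
qed

lemma discrete_eigenvalues_eq: "discrete_eigenvalues N = map \<mu> [1..<N]"
proof -
  let ?xs = "map \<mu> [1..<N]"
  have sorted: "sorted ?xs"
    unfolding sorted_iff_nth_mono_less
  proof (intro allI impI)
    fix i j assume "i < j" "j < length ?xs"
    then show "?xs ! i \<le> ?xs ! j" using eig_less[of "1 + i" "1 + j"] by (auto simp: less_diff_conv)
  qed
  have dist: "distinct ?xs" using inj_eig by (simp add: distinct_map)
  have "count (mset ?xs) \<nu> = discrete_multiplicity N \<nu>" for \<nu>
    using distinct_count_atmost_1[of ?xs] dist by (auto simp: discrete_multiplicity_eq)
  then have count: "count_list ?xs \<nu> = discrete_multiplicity N \<nu>" for \<nu>
    by (simp only: count_mset)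
  show ?thesis
    unfolding discrete_eigenvalues_def
  proof (rule the_equality)
    fix ys assume ys: "sorted ys \<and> (\<forall>\<nu>. count_list ys \<nu> = discrete_multiplicity N \<nu>)"
    then have "mset ys = mset ?xs" using count by (intro multiset_eqI) (simp only: count_mset)
    then show "ys = ?xs" using ys sorted by (metis properties_for_sort)
  qed (use sorted count in auto)
qed

lemma discrete_eigenvalue_eq:
  assumes "k \<in> {1..<N}" shows "discrete_eigenvalue N k = \<mu> k"
  using assms unfolding discrete_eigenvalue_def discrete_eigenvalues_eq
  by (subst nth_map) auto

end

section \<open>Explicit solutions of the difference scheme\<close>

text \<open>For a wave number \<open>\<theta>\<close>, the rate \<open>\<phi>\<close> of the non-oscillating solutions \<open>e\<^sup>\<phi>\<^sup>j\<close> and \<open>e\<^sup>-\<^sup>\<phi>\<^sup>j\<close> with the same eigenvalue as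
\<open>e\<^sup>i\<^sup>\<theta>\<^sup>j\<close>. For a given \<open>m = (1 - c)\<^sup>2 / (2 + c)\<close> the two roots \<open>c\<close> have sum \<open>2 + m\<close>; one is
\<open>cos \<theta>\<close> and the other is \<open>cosh \<phi>\<close>.\<close>

definition evanescent_rate :: "real \<Rightarrow> real" where
  "evanescent_rate \<theta> = arcosh ((5 - 2 * cos \<theta>) / (2 + cos \<theta>))"

text \<open>A third of the factor, up to the phase shift, by which the Hermitian derivative (times \<open>h\<close>) multiplies the waves \<open>cos (\<theta> j)\<close>
and \<open>sin (\<theta> j)\<close>; \<open>evanescent_ratio\<close> is its counterpart for \<open>cosh (\<phi> j)\<close> and \<open>sinh (\<phi> j)\<close>.\<close>

definition oscillating_ratio :: "real \<Rightarrow> real" where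
  "oscillating_ratio \<theta> = sin \<theta> / (2 + cos \<theta>)"

definition evanescent_ratio :: "real \<Rightarrow> real" where
  "evanescent_ratio \<theta> = sinh (evanescent_rate \<theta>) / (2 + cosh (evanescent_rate \<theta>))"

text \<open>The eigenvalue times \<open>h\<^sup>4\<close> as a function of the wave number.\<close>

definition dispersion :: "real \<Rightarrow> real" where
  "dispersion \<theta> = 12 * (1 - cos \<theta>) * (1 - cos \<theta>) / (2 + cos \<theta>)"

lemma two_plus_cos_pos: "2 + cos \<theta> > (0::real)"
  using cos_ge_minus_one[of \<theta>] by linarith

lemma two_plus_cosh_pos: "2 + cosh \<phi> > (0::real)"
  using cosh_real_pos[of \<phi>] by linarith

lemma cosh_evanescent_arg: "1 \<le> (5 - 2 * cos \<theta>) / (2 + cos (\<theta>::real))"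
  using two_plus_cos_pos[of \<theta>] cos_le_one[of \<theta>] by (simp add: field_simps)

lemma cosh_evanescent_rate: "cosh (evanescent_rate \<theta>) = (5 - 2 * cos \<theta>) / (2 + cos \<theta>)"
  using cosh_evanescent_arg by (simp add: evanescent_rate_def)

lemma evanescent_rate_nonneg: "evanescent_rate \<theta> \<ge> 0"
  using cosh_evanescent_arg by (simp add: evanescent_rate_def)

lemma cos_less_one:
  assumes "0 < \<theta>" "\<theta> \<le> pi" shows "cos \<theta> < 1"
  using cos_monotone_0_pi[of 0 \<theta>] assms by simp

lemma evanescent_rate_pos:
  assumes "0 < \<theta>" "\<theta> \<le> pi" shows "evanescent_rate \<theta> > 0"
proof -
  have "(5 - 2 * cos \<theta>) / (2 + cos \<theta>) \<noteq> 1"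
    using cos_less_one[OF assms] two_plus_cos_pos[of \<theta>] by (simp add: field_simps)
  then show ?thesis
    unfolding evanescent_rate_def arcosh_real_gt_1_iff[OF cosh_evanescent_arg] .
qed

lemma oscillating_ratio_mult: "oscillating_ratio \<theta> * (2 + cos \<theta>) = sin \<theta>"
  using two_plus_cos_pos[of \<theta>] by (simp add: oscillating_ratio_def)

lemma evanescent_ratio_mult:
  "evanescent_ratio \<theta> * (2 + cosh (evanescent_rate \<theta>)) = sinh (evanescent_rate \<theta>)"
  using two_plus_cosh_pos[of "evanescent_rate \<theta>"] by (simp add: evanescent_ratio_def)

lemma dispersion_oscillating:
  "12 * (2 * (1 - cos \<theta>) - 3 * oscillating_ratio \<theta> * sin \<theta>) = dispersion \<theta>"
proof -
  have "12 * (2 * (1 - cos \<theta>) * (2 + cos \<theta>) - 3 * (sin \<theta>)\<^sup>2) = 12 * (1 - cos \<theta>) * (1 - cos \<theta>)"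
    unfolding sin_squared_eq by algebra
  then show ?thesis using two_plus_cos_pos[of \<theta>]
    unfolding dispersion_def oscillating_ratio_def
    by (simp add: divide_simps power2_eq_square)
qed

lemma dispersion_evanescent:
  "12 * (3 * evanescent_ratio \<theta> * sinh (evanescent_rate \<theta>)
     - 2 * (cosh (evanescent_rate \<theta>) - 1)) = dispersion \<theta>"
proof -
  define C where "C = cosh (evanescent_rate \<theta>)"
  have C: "C = (5 - 2 * cos \<theta>) / (2 + cos \<theta>)" by (simp add: C_def cosh_evanescent_rate)
  have pos: "2 + cos \<theta> > 0" "2 + C > 0"
    using two_plus_cos_pos[of \<theta>] two_plus_cosh_pos[of "evanescent_rate \<theta>"] by (auto simp: C_def)
  have "evanescent_ratio \<theta> * sinh (evanescent_rate \<theta>) = (sinh (evanescent_rate \<theta>))\<^sup>2 / (2 + C)"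
    by (simp add: evanescent_ratio_def C_def power2_eq_square)
  also have "(sinh (evanescent_rate \<theta>))\<^sup>2 = C\<^sup>2 - 1"
    unfolding C_def cosh_square_eq by simp
  finally have "12 * (3 * evanescent_ratio \<theta> * sinh (evanescent_rate \<theta>) - 2 * (C - 1)) =
      12 * (3 * (C\<^sup>2 - 1) / (2 + C) - 2 * (C - 1))" by simp
  also have "\<dots> = 12 * (C - 1)\<^sup>2 / (2 + C)"
    using pos by (simp add: field_simps power2_eq_square)
  also have "\<dots> = dispersion \<theta>"
  proof -
    have C1: "C - 1 = 3 * (1 - cos \<theta>) / (2 + cos \<theta>)"
      using pos by (simp add: C field_simps)
    have C2: "2 + C = 9 / (2 + cos \<theta>)"
      using pos by (simp add: C field_simps)
    show ?thesis unfolding C1 C2 dispersion_def using pos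
      by (simp add: power2_eq_square divide_simps) algebra
  qed
  finally show ?thesis unfolding C_def .
qed

text \<open>The two-parameter family of solutions whose value and Hermitian derivative vanish at \<open>0\<close>;
\<open>mode_slope\<close> is \<open>h\<close> times the Hermitian derivative of \<open>mode_value\<close>. They are functions of a real variable, so
that shifts by one grid cell are instances of the addition theorems.\<close>

definition mode_value :: "real \<Rightarrow> real \<Rightarrow> real \<Rightarrow> real \<Rightarrow> real" where
  "mode_value A B \<theta> x =
     A * (cosh (evanescent_rate \<theta> * x) - cos (\<theta> * x)) +
     B * (oscillating_ratio \<theta> * sinh (evanescent_rate \<theta> * x) - evanescent_ratio \<theta> * sin (\<theta> * x))"

definition mode_slope :: "real \<Rightarrow> real \<Rightarrow> real \<Rightarrow> real \<Rightarrow> real" where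
  "mode_slope A B \<theta> x =
     3 * (A * (evanescent_ratio \<theta> * sinh (evanescent_rate \<theta> * x) + oscillating_ratio \<theta> * sin (\<theta> * x)) +
     B * (oscillating_ratio \<theta> * evanescent_ratio \<theta> * (cosh (evanescent_rate \<theta> * x) - cos (\<theta> * x))))"

lemma shift_simps:
  fixes t x :: real
  shows "cos (t * (x + 1)) = cos (t * x) * cos t - sin (t * x) * sin t"
    "cos (t * (x - 1)) = cos (t * x) * cos t + sin (t * x) * sin t"
    "sin (t * (x + 1)) = sin (t * x) * cos t + cos (t * x) * sin t"
    "sin (t * (x - 1)) = sin (t * x) * cos t - cos (t * x) * sin t"
    "cosh (t * (x + 1)) = cosh (t * x) * cosh t + sinh (t * x) * sinh t"
    "cosh (t * (x - 1)) = cosh (t * x) * cosh t - sinh (t * x) * sinh t"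
    "sinh (t * (x + 1)) = sinh (t * x) * cosh t + cosh (t * x) * sinh t"
    "sinh (t * (x - 1)) = sinh (t * x) * cosh t - cosh (t * x) * sinh t"
  by (simp_all add: distrib_left right_diff_distrib cos_add cos_diff sin_add sin_diff
      cosh_add cosh_diff sinh_add sinh_diff)

lemma mode_slope_hermitian:
  "(mode_slope A B \<theta> (x - 1) + 4 * mode_slope A B \<theta> x + mode_slope A B \<theta> (x + 1)) / 6 =
   (mode_value A B \<theta> (x + 1) - mode_value A B \<theta> (x - 1)) / 2"
proof -
  have *: "mode_slope A B \<theta> (x - 1) + 4 * mode_slope A B \<theta> x + mode_slope A B \<theta> (x + 1) =
     3 * (mode_value A B \<theta> (x + 1) - mode_value A B \<theta> (x - 1))"
    unfolding mode_slope_def mode_value_def shift_simps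
      oscillating_ratio_mult[of \<theta>, symmetric] evanescent_ratio_mult[of \<theta>, symmetric]
    by algebra
  show ?thesis unfolding * by simp
qed

lemma mode_biharmonic:
  "12 * ((mode_slope A B \<theta> (x + 1) - mode_slope A B \<theta> (x - 1)) / 2 -
     (mode_value A B \<theta> (x + 1) - 2 * mode_value A B \<theta> x + mode_value A B \<theta> (x - 1))) =
   dispersion \<theta> * mode_value A B \<theta> x"
proof -
  let ?c = "cos (\<theta> * x)" and ?s = "sin (\<theta> * x)"
    and ?C = "cosh (evanescent_rate \<theta> * x)" and ?S = "sinh (evanescent_rate \<theta> * x)"
  define P where "P = 12 * (2 * (1 - cos \<theta>) - 3 * oscillating_ratio \<theta> * sin \<theta>)"
  define Q where "Q = 12 * (3 * evanescent_ratio \<theta> * sinh (evanescent_rate \<theta>)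
     - 2 * (cosh (evanescent_rate \<theta>) - 1))"
  have "12 * ((mode_slope A B \<theta> (x + 1) - mode_slope A B \<theta> (x - 1)) -
     2 * (mode_value A B \<theta> (x + 1) - 2 * mode_value A B \<theta> x + mode_value A B \<theta> (x - 1))) =
   2 * (A * (?C * Q - ?c * P) +
     B * (oscillating_ratio \<theta> * ?S * Q - evanescent_ratio \<theta> * ?s * P))"
    unfolding mode_slope_def mode_value_def shift_simps P_def Q_def by algebra
  also have "P = dispersion \<theta>" unfolding P_def by (rule dispersion_oscillating)
  also have "Q = dispersion \<theta>" unfolding Q_def by (rule dispersion_evanescent)
  also have "2 * (A * (?C * dispersion \<theta> - ?c * dispersion \<theta>) +
     B * (oscillating_ratio \<theta> * ?S * dispersion \<theta> - evanescent_ratio \<theta> * ?s * dispersion \<theta>)) =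
     2 * (dispersion \<theta> * mode_value A B \<theta> x)"
    unfolding mode_value_def by algebra
  finally show ?thesis by (simp add: field_simps)
qed

lemma mode_at_0: "mode_value A B \<theta> 0 = 0" "mode_slope A B \<theta> 0 = 0"
  by (simp_all add: mode_value_def mode_slope_def)

definition grid_mode :: "nat \<Rightarrow> real \<Rightarrow> real \<Rightarrow> real \<Rightarrow> nat \<Rightarrow> real" where
  "grid_mode N A B \<theta> j = (if j \<le> N then mode_value A B \<theta> (real j) else 0)"

lemma discrete_mode_grid_mode:
  assumes N: "N \<ge> 1" and end_values: "mode_value A B \<theta> (real N) = 0" "mode_slope A B \<theta> (real N) = 0"
  shows "discrete_mode N (real N ^ 4 * dispersion \<theta>) (grid_mode N A B \<theta>)"
  unfolding discrete_mode_def
proof (intro conjI bexI ballI allI)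
  let ?v = "grid_mode N A B \<theta>"
  let ?p = "\<lambda>j. if j \<le> N then real N * mode_slope A B \<theta> (real j) else 0"
  show "?v \<in> grid0 N" "?p \<in> grid0 N"
    using end_values by (auto simp: grid0_def grid_mode_def mode_at_0)
  have shift: "real (j + 1) = real j + 1" "real (j - 1) = real j - 1" "j - 1 \<le> N" "j \<le> N" "j + 1 \<le> N"
    if "j \<in> {1..N - 1}" for j using that N by auto
  have dx: "delta_x N ?v j = real N * ((mode_value A B \<theta> (real j + 1) - mode_value A B \<theta> (real j - 1)) / 2)"
    if "j \<in> {1..N - 1}" for j
    using shift[OF that] that by (auto simp: delta_x_def mesh_def grid_mode_def add.commute)
  show "1/6 * ?p (j - 1) + 2/3 * ?p j + 1/6 * ?p (j + 1) = delta_x N ?v j" if j: "j \<in> {1..N - 1}" for j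
  proof -
    have "1/6 * ?p (j - 1) + 2/3 * ?p j + 1/6 * ?p (j + 1) = real N *
      ((mode_slope A B \<theta> (real j - 1) + 4 * mode_slope A B \<theta> (real j) + mode_slope A B \<theta> (real j + 1)) / 6)"
      using shift[OF j] by (simp add: algebra_simps add_divide_distrib)
    then show ?thesis unfolding dx[OF j] mode_slope_hermitian .
  qed
  show "12 / (mesh N)\<^sup>2 * (delta_x N ?p j - delta_x2 N ?v j) = real N ^ 4 * dispersion \<theta> * ?v j" for j
  proof (cases "j \<in> {1..N - 1}")
    case True
    have d1: "delta_x N ?p j = (real N)\<^sup>2 * ((mode_slope A B \<theta> (real j + 1) - mode_slope A B \<theta> (real j - 1)) / 2)"
      using shift[OF True] True by (auto simp: delta_x_def mesh_def power2_eq_square algebra_simps)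
    have d2: "delta_x2 N ?v j = (real N)\<^sup>2 *
        (mode_value A B \<theta> (real j + 1) - 2 * mode_value A B \<theta> (real j) + mode_value A B \<theta> (real j - 1))"
      using shift[OF True] True
      by (auto simp: delta_x2_def mesh_def power2_eq_square algebra_simps grid_mode_def)
    have d3: "12 / (mesh N)\<^sup>2 = 12 * (real N)\<^sup>2"
      by (simp add: mesh_def power_divide)
    have "12 / (mesh N)\<^sup>2 * (delta_x N ?p j - delta_x2 N ?v j) = real N ^ 4 *
        (12 * ((mode_slope A B \<theta> (real j + 1) - mode_slope A B \<theta> (real j - 1)) / 2 -
     (mode_value A B \<theta> (real j + 1) - 2 * mode_value A B \<theta> (real j) + mode_value A B \<theta> (real j - 1))))"
      unfolding d1 d2 d3 by algebra
    also have "\<dots> = real N ^ 4 * dispersion \<theta> * ?v j"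
      unfolding mode_biharmonic using shift[OF True] by (simp add: grid_mode_def)
    finally show ?thesis .
  next
    case False
    then have "j = 0 \<or> j \<ge> N" by auto
    then have "?v j = 0" using \<open>?v \<in> grid0 N\<close> unfolding grid0_def by blast
    then show ?thesis using False by (auto simp: delta_x_def delta_x2_def)
  qed
qed

section \<open>The discrete characteristic function and its roots\<close>

text \<open>The Chebyshev polynomial of the second kind of degree \<open>n - 1\<close> at \<open>cos \<theta>\<close>. It is \<open>sin (n \<theta>) / sin \<theta>\<close>
with the removable singularity at \<open>\<pi>\<close> removed.\<close>

primrec chebyshev_U :: "nat \<Rightarrow> real \<Rightarrow> real" where
  "chebyshev_U 0 \<theta> = 0"
| "chebyshev_U (Suc n) \<theta> = cos \<theta> * chebyshev_U n \<theta> + cos (real n * \<theta>)"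

lemma sin_mult_chebyshev_U: "sin \<theta> * chebyshev_U n \<theta> = sin (real n * \<theta>)"
  by (induction n) (simp_all add: algebra_simps sin_add)

lemma continuous_chebyshev_U: "continuous_on S (chebyshev_U n)"
  by (induction n) (auto intro!: continuous_intros)

lemma chebyshev_U_pi: "chebyshev_U n pi = - ((-1) ^ n * real n)"
  by (induction n) (simp_all add: algebra_simps cos_npi)

text \<open>The determinant of the two conditions at the right end, divided by \<open>sin \<theta>\<close>. The determinant itself
vanishes at \<open>\<theta> = \<pi>\<close>; without this factor the last interval, ending at \<open>\<pi>\<close>, also shows a change of sign,
and so contributes the last of the \<open>N - 1\<close> eigenvalues.\<close>

definition discrete_char :: "nat \<Rightarrow> real \<Rightarrow> real" where
  "discrete_char N \<theta> =
     2 * evanescent_ratio \<theta> * (1 - cosh (evanescent_rate \<theta> * real N) * cos (\<theta> * real N)) / (2 + cos \<theta>) +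
     chebyshev_U N \<theta> * ((evanescent_ratio \<theta>)\<^sup>2 - (oscillating_ratio \<theta>)\<^sup>2) * sinh (evanescent_rate \<theta> * real N)"

lemma sin_mult_discrete_char:
  "sin \<theta> * discrete_char N \<theta> =
     2 * oscillating_ratio \<theta> * evanescent_ratio \<theta> *
       (1 - cosh (evanescent_rate \<theta> * real N) * cos (\<theta> * real N)) +
     ((evanescent_ratio \<theta>)\<^sup>2 - (oscillating_ratio \<theta>)\<^sup>2) *
       sin (\<theta> * real N) * sinh (evanescent_rate \<theta> * real N)"
proof -
  have "sin (\<theta> * real N) = sin \<theta> * chebyshev_U N \<theta>"
    by (simp add: sin_mult_chebyshev_U mult.commute)
  then show ?thesis
    by (simp add: discrete_char_def oscillating_ratio_def[of \<theta>] distrib_left)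
qed

lemma continuous_discrete_char: "continuous_on S (discrete_char N)"
proof -
  have rate: "continuous_on S evanescent_rate"
    unfolding evanescent_rate_def[abs_def] using cosh_evanescent_arg two_plus_cos_pos
    by (intro continuous_intros) (auto simp: less_imp_neq[symmetric])
  have "continuous_on S oscillating_ratio"
    unfolding oscillating_ratio_def[abs_def] using two_plus_cos_pos
    by (intro continuous_intros) (auto simp: less_imp_neq[symmetric])
  moreover have "continuous_on S evanescent_ratio"
    unfolding evanescent_ratio_def[abs_def] using two_plus_cosh_pos
    by (intro continuous_intros rate) (auto simp: less_imp_neq[symmetric])
  ultimately show ?thesis
    unfolding discrete_char_def[abs_def] using two_plus_cos_pos
    by (intro continuous_intros rate continuous_chebyshev_U) (auto simp: less_imp_neq[symmetric])
qed

lemma evanescent_ratio_pos: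
  assumes "0 < \<theta>" "\<theta> \<le> pi" shows "evanescent_ratio \<theta> > 0"
  using evanescent_rate_pos[OF assms] two_plus_cosh_pos[of "evanescent_rate \<theta>"]
  by (simp add: evanescent_ratio_def)

text \<open>At \<open>\<theta> = j \<pi> / N\<close> with \<open>j < N\<close> the Chebyshev term is zero and the sign is that of
\<open>1 - (-1)\<^sup>j cosh b\<close>. At \<open>j = N\<close> the oscillating ratio is zero and both terms have this sign.\<close>

lemma discrete_char_sign:
  assumes j: "j \<in> {1..N}"
  shows "(-1) ^ j * discrete_char N (real j * pi / real N) < 0"
proof -
  define \<theta> where "\<theta> = real j * pi / real N"
  have N: "real N > 0" using j by simp
  have \<theta>: "0 < \<theta>" "\<theta> \<le> pi" using j N by (auto simp: \<theta>_def field_simps)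
  have \<theta>N: "\<theta> * real N = real j * pi" using N by (simp add: \<theta>_def)
  have rate: "evanescent_rate \<theta> * real N > 0" using evanescent_rate_pos[OF \<theta>] N by simp
  have sq: "(-1) ^ j * ((-1) ^ j :: real) = 1" by (simp flip: power_mult_distrib)
  have "(-1) ^ j * (1 - cosh (evanescent_rate \<theta> * real N) * cos (\<theta> * real N)) =
      (-1) ^ j - cosh (evanescent_rate \<theta> * real N)"
  proof -
    have "e * (1 - C * e) = e - C" if "e * e = 1" for e C :: real
      using that by algebra
    from this[OF sq] show ?thesis unfolding \<theta>N cos_npi .
  qed
  also have "\<dots> < 0"
    using cosh_gt_one[OF rate] minus_one_power_le_one[of j] by linarith
  finally have 1: "(-1) ^ j * (2 * evanescent_ratio \<theta> *
       (1 - cosh (evanescent_rate \<theta> * real N) * cos (\<theta> * real N)) / (2 + cos \<theta>)) < 0"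
    using evanescent_ratio_pos[OF \<theta>] two_plus_cos_pos[of \<theta>]
    by (simp add: divide_less_0_iff mult_less_0_iff zero_less_mult_iff)
  have 2: "(-1) ^ j * (chebyshev_U N \<theta> * ((evanescent_ratio \<theta>)\<^sup>2 - (oscillating_ratio \<theta>)\<^sup>2) *
       sinh (evanescent_rate \<theta> * real N)) \<le> 0"
  proof (cases "j = N")
    case True
    then have [simp]: "\<theta> = pi" using N by (simp add: \<theta>_def)
    have "(-1) ^ j * (chebyshev_U N \<theta> * ((evanescent_ratio \<theta>)\<^sup>2 - (oscillating_ratio \<theta>)\<^sup>2) *
       sinh (evanescent_rate \<theta> * real N)) =
       - (real N * (evanescent_ratio pi)\<^sup>2 * sinh (evanescent_rate pi * real N))"
      using sq True by (simp add: chebyshev_U_pi oscillating_ratio_def)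
    then show ?thesis using rate by simp
  next
    case False
    then have "\<theta> < pi" using j N by (auto simp: \<theta>_def field_simps)
    then have "sin \<theta> \<noteq> 0" using sin_gt_zero[of \<theta>] \<theta> by simp
    moreover have "sin \<theta> * chebyshev_U N \<theta> = 0"
      unfolding sin_mult_chebyshev_U mult.commute[of "real N"] \<theta>N sin_npi ..
    ultimately show ?thesis by simp
  qed
  show ?thesis using 1 2 unfolding \<theta>_def[symmetric] discrete_char_def distrib_left by linarith
qed

lemma ex_discrete_angle:
  assumes k: "k \<in> {1..<N}"
  shows "\<exists>\<theta>. real k * pi / real N < \<theta> \<and> \<theta> < (real k + 1) * pi / real N \<and> discrete_char N \<theta> = 0"
proof -
  let ?l = "real k * pi / real N" and ?r = "(real k + 1) * pi / real N"
  let ?f = "\<lambda>\<theta>. (-1) ^ k * discrete_char N \<theta>"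
  have l: "?f ?l < 0" using discrete_char_sign[of k N] k by auto
  have r: "?f ?r > 0" using discrete_char_sign[of "Suc k" N] k by (auto simp: add.commute)
  have "?l \<le> ?r" by (intro divide_right_mono) (auto simp: algebra_simps)
  then have "\<exists>\<theta>\<ge>?l. \<theta> \<le> ?r \<and> ?f \<theta> = 0"
    using l r by (intro IVT') (auto intro!: continuous_intros continuous_discrete_char)
  then obtain \<theta> where \<theta>: "?l \<le> \<theta>" "\<theta> \<le> ?r" "?f \<theta> = 0" by blast
  then have "\<theta> \<noteq> ?l" "\<theta> \<noteq> ?r" using l r by auto
  with \<theta> show ?thesis by (intro exI[of _ \<theta>]) auto
qed

definition discrete_angle :: "nat \<Rightarrow> nat \<Rightarrow> real" where
  "discrete_angle N k =
     (SOME \<theta>. real k * pi / real N < \<theta> \<and> \<theta> < (real k + 1) * pi / real N \<and> discrete_char N \<theta> = 0)"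

lemma discrete_angle:
  assumes "k \<in> {1..<N}"
  shows "real k * pi / real N < discrete_angle N k" "discrete_angle N k < (real k + 1) * pi / real N"
    "discrete_char N (discrete_angle N k) = 0"
  using someI_ex[OF ex_discrete_angle[OF assms]] unfolding discrete_angle_def by blast+

lemma discrete_angle_bounds:
  assumes k: "k \<in> {1..<N}"
  shows "0 < discrete_angle N k" "discrete_angle N k < pi"
proof -
  have "0 \<le> real k * pi / real N" by simp
  then show "0 < discrete_angle N k" using discrete_angle(1)[OF k] by linarith
  have "(real k + 1) * pi \<le> real N * pi" using k by (intro mult_right_mono) auto
  then have "(real k + 1) * pi / real N \<le> pi" using k by (simp add: field_simps)
  then show "discrete_angle N k < pi" using discrete_angle(2)[OF k] by linarith
qed

lemma dispersion_strict_mono: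
  assumes "0 \<le> x" "x < y" "y \<le> pi"
  shows "dispersion x < dispersion y"
proof -
  have c: "cos y < cos x" using assms by (intro cos_monotone_0_pi) auto
  have "(1 - cos x) * (1 - cos x) < (1 - cos y) * (1 - cos y)"
    using c cos_le_one[of x] by (intro mult_strict_mono') auto
  moreover have "0 < 2 + cos y" "2 + cos y \<le> 2 + cos x" using c two_plus_cos_pos[of y] by auto
  ultimately show ?thesis
    unfolding dispersion_def mult.assoc using cos_le_one[of x]
    by (intro frac_less) auto
qed

text \<open>The second-order operator annihilating \<open>cos (\<theta> x)\<close> and \<open>sin (\<theta> x)\<close>, evaluated at the grid points \<open>1\<close> and \<open>2\<close>, leaves
two equations for the coefficients of \<open>cosh\<close> and \<open>sinh\<close>. Both points are interior as soon as \<open>N \<ge> 3\<close>.\<close>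

lemma grid_mode_nonzero:
  assumes N: "N \<ge> 3" and \<theta>: "0 < \<theta>" "\<theta> < pi" and B: "B \<noteq> 0"
  shows "\<exists>j. grid_mode N A B \<theta> j \<noteq> 0"
proof (rule ccontr)
  assume "\<not> ?thesis"
  then have z: "grid_mode N A B \<theta> j = 0" for j by blast
  have z1: "mode_value A B \<theta> 1 = 0" using z[of 1] N by (simp add: grid_mode_def)
  have z2: "mode_value A B \<theta> 2 = 0" using z[of 2] N by (simp add: grid_mode_def)
  have z3: "mode_value A B \<theta> 3 = 0" using z[of 3] N by (simp add: grid_mode_def)
  define \<phi> S where "\<phi> = evanescent_rate \<theta>" and "S = oscillating_ratio \<theta>"
  have \<phi>: "\<phi> > 0" using evanescent_rate_pos[of \<theta>] \<theta> by (simp add: \<phi>_def)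
  have ne: "cosh \<phi> - cos \<theta> \<noteq> 0" using cosh_gt_one[OF \<phi>] cos_le_one[of \<theta>] by linarith
  have step: "mode_value A B \<theta> (x + 1) - 2 * cos \<theta> * mode_value A B \<theta> x + mode_value A B \<theta> (x - 1) =
     2 * (cosh \<phi> - cos \<theta>) * (A * cosh (\<phi> * x) + B * S * sinh (\<phi> * x))" for x
    unfolding mode_value_def shift_simps \<phi>_def S_def by algebra
  have "A * cosh (\<phi> * 1) + B * S * sinh (\<phi> * 1) = 0"
    using step[of 1] z1 z2 mode_at_0 ne by simp
  moreover have "A * cosh (\<phi> * (1 + 1)) + B * S * sinh (\<phi> * (1 + 1)) = 0"
    using step[of 2] z1 z2 z3 ne by simp
  ultimately have "B * S * (sinh (\<phi> * (1 + 1)) * cosh (\<phi> * 1) - cosh (\<phi> * (1 + 1)) * sinh (\<phi> * 1)) = 0"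
    by algebra
  also have "sinh (\<phi> * (1 + 1)) * cosh (\<phi> * 1) - cosh (\<phi> * (1 + 1)) * sinh (\<phi> * 1) = sinh \<phi>"
    using sinh_diff[of "\<phi> * (1 + 1)" "\<phi> * 1"] by (simp add: algebra_simps)
  finally have "B * S * sinh \<phi> = 0" .
  moreover have "S > 0"
    using sin_gt_zero[of \<theta>] \<theta> two_plus_cos_pos[of \<theta>] by (simp add: S_def oscillating_ratio_def)
  ultimately show False using B \<phi> by simp
qed

lemma ex_discrete_mode:
  assumes N: "N \<ge> 3" and \<theta>: "0 < \<theta>" "\<theta> < pi" and char: "discrete_char N \<theta> = 0"
  shows "\<exists>v. discrete_mode N (real N ^ 4 * dispersion \<theta>) v \<and> (\<exists>j. v j \<noteq> 0)"
proof -
  define a b where "a = \<theta> * real N" and "b = evanescent_rate \<theta> * real N"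
  \<comment> \<open>The solution of the condition \<open>mode_value = 0\<close> at the right end; the slope there is then a
    multiple of the characteristic function.\<close>
  define A where "A = oscillating_ratio \<theta> * sinh b - evanescent_ratio \<theta> * sin a"
  define B where "B = - (cosh b - cos a)"
  have "b > 0" using evanescent_rate_pos[of \<theta>] \<theta> N by (simp add: b_def)
  then have "B < 0" using cosh_gt_one[of b] cos_le_one[of a] unfolding B_def by linarith
  then have B: "B \<noteq> 0" by simp
  have "mode_value A B \<theta> (real N) = 0"
    unfolding mode_value_def a_def[symmetric] b_def[symmetric] A_def B_def by algebra
  moreover have "mode_slope A B \<theta> (real N) = - 3 * (sin \<theta> * discrete_char N \<theta>)"
    using cosh_square_eq[of b] sin_squared_eq[of a]
    unfolding sin_mult_discrete_char mode_slope_def a_def[symmetric] b_def[symmetric] A_def B_def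
    by algebra
  ultimately have "discrete_mode N (real N ^ 4 * dispersion \<theta>) (grid_mode N A B \<theta>)"
    using char N by (intro discrete_mode_grid_mode) auto
  then show ?thesis using grid_mode_nonzero[OF N \<theta> B] by blast
qed

text \<open>The roots found in consecutive intervals give increasing eigenvalues because the dispersion
relation is increasing, so the list of eigenvalues is in the order of the intervals.\<close>

lemma discrete_eigenvalue_eq_dispersion:
  assumes N: "N \<ge> 3" and k: "k \<in> {1..<N}"
  shows "discrete_eigenvalue N k = real N ^ 4 * dispersion (discrete_angle N k)"
proof -
  have "\<exists>v. discrete_mode N (real N ^ 4 * dispersion (discrete_angle N i)) v \<and> (\<exists>j. v j \<noteq> 0)"
    if "i \<in> {1..<N}" for i
    using that by (intro ex_discrete_mode N discrete_angle_bounds discrete_angle)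
  then obtain v where v: "\<And>i. i \<in> {1..<N} \<Longrightarrow>
      discrete_mode N (real N ^ 4 * dispersion (discrete_angle N i)) (v i) \<and> (\<exists>j. v i j \<noteq> 0)"
    by metis
  interpret complete_modes N "\<lambda>i. real N ^ 4 * dispersion (discrete_angle N i)" v
  proof
    fix i j assume ij: "i \<in> {1..<N}" "j \<in> {1..<N}" "i < j"
    have "real i + 1 \<le> real j" using ij by simp
    then have "(real i + 1) * pi / real N \<le> real j * pi / real N"
      by (intro divide_right_mono mult_right_mono) auto
    then have "discrete_angle N i < discrete_angle N j"
      using discrete_angle(2)[OF ij(1)] discrete_angle(1)[OF ij(2)] by linarith
    then have "dispersion (discrete_angle N i) < dispersion (discrete_angle N j)"
      using discrete_angle_bounds[OF ij(1)] discrete_angle_bounds[OF ij(2)]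
      by (intro dispersion_strict_mono) auto
    then show "real N ^ 4 * dispersion (discrete_angle N i) < real N ^ 4 * dispersion (discrete_angle N j)"
      using N by simp
  qed (use N v in auto)
  show ?thesis by (rule discrete_eigenvalue_eq[OF k])
qed

section \<open>Fourth-order convergence\<close>

text \<open>In the continuous limit the two ratios coincide (both are \<open>w / (3 N)\<close> to leading order). Their squares agree up to fourth order
in \<open>1 - cos \<theta>\<close>, which makes the coupling term of the discrete characteristic function negligible.\<close>

lemma evanescent_ratio_sq_diff:
  "(evanescent_ratio \<theta>)\<^sup>2 - (oscillating_ratio \<theta>)\<^sup>2 = (1 - cos \<theta>) ^ 4 / (27 * (2 + cos \<theta>)\<^sup>2)"
proof -
  define c C s T S where "c = cos \<theta>" and "C = cosh (evanescent_rate \<theta>)"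
    and "s = sinh (evanescent_rate \<theta>)" and "T = evanescent_ratio \<theta>" and "S = oscillating_ratio \<theta>"
  have c: "2 + c > 0" using two_plus_cos_pos[of \<theta>] by (simp add: c_def)
  have C: "C * (2 + c) = 5 - 2 * c" using c by (simp add: C_def c_def cosh_evanescent_rate)
  have s: "s\<^sup>2 = C\<^sup>2 - 1" by (simp add: s_def C_def sinh_square_eq)
  have Ts: "T * (2 + C) = s" unfolding T_def C_def s_def by (rule evanescent_ratio_mult)
  have "s * (2 + c) = T * (2 * (2 + c) + C * (2 + c))" unfolding Ts[symmetric] by algebra
  then have "T * 9 = s * (2 + c)" unfolding C by simp
  then have "(T * 9)\<^sup>2 = (C * (2 + c))\<^sup>2 - (2 + c)\<^sup>2" using s by algebra
  then have "81 * T\<^sup>2 = (5 - 2 * c)\<^sup>2 - (2 + c)\<^sup>2" unfolding C by algebra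
  also have "\<dots> = 3 * ((1 - c) * (7 - c))" by algebra
  finally have T: "27 * T\<^sup>2 = (1 - c) * (7 - c)" by simp
  have "S * (2 + c) = sin \<theta>" unfolding S_def c_def by (rule oscillating_ratio_mult)
  then have S: "S\<^sup>2 * (2 + c)\<^sup>2 = 1 - c\<^sup>2"
    unfolding c_def by (metis power_mult_distrib sin_squared_eq)
  have "(T\<^sup>2 - S\<^sup>2) * (27 * (2 + c)\<^sup>2) = (27 * T\<^sup>2) * (2 + c)\<^sup>2 - 27 * (S\<^sup>2 * (2 + c)\<^sup>2)"
    by algebra
  also have "\<dots> = (1 - c) ^ 4" unfolding T S by algebra
  finally show ?thesis using c
    unfolding T_def[symmetric] S_def[symmetric] c_def[symmetric] by (simp add: eq_divide_eq)
qed

text \<open>Dividing the characteristic equation by \<open>2 S T\<close>, where \<open>S\<close> and \<open>T\<close> are the two ratios, leaves the coupling term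
with the factor \<open>(T\<^sup>2 - S\<^sup>2) / (2 S T)\<close>; since \<open>S \<le> T\<close>, replacing \<open>T\<close> by \<open>S\<close> in the denominator bounds it.\<close>

lemma discrete_char_zero_bound:
  assumes \<theta>: "0 < \<theta>" "\<theta> < pi" and zero: "discrete_char N \<theta> = 0"
  shows "\<bar>cosh (evanescent_rate \<theta> * real N) * cos (\<theta> * real N) - 1\<bar> \<le>
    (1 - cos \<theta>) ^ 3 / (54 * (1 + cos \<theta>)) * sinh (evanescent_rate \<theta> * real N)"
proof -
  define a b S T c where "a = \<theta> * real N" and "b = evanescent_rate \<theta> * real N"
    and "S = oscillating_ratio \<theta>" and "T = evanescent_ratio \<theta>" and "c = cos \<theta>"
  have c: "c > -1" "c < 1" using cos_less_one[of \<theta>] \<theta> cos_monotone_0_pi[of \<theta> pi] by (auto simp: c_def)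
  have S: "S > 0" using sin_gt_zero[of \<theta>] \<theta> two_plus_cos_pos[of \<theta>] by (simp add: S_def oscillating_ratio_def)
  have T: "T > 0" using evanescent_ratio_pos[of \<theta>] \<theta> by (simp add: T_def)
  have b: "sinh b \<ge> 0" using evanescent_rate_nonneg[of \<theta>] by (simp add: b_def)
  have diff: "T\<^sup>2 - S\<^sup>2 = (1 - c) ^ 4 / (27 * (2 + c)\<^sup>2)"
    unfolding T_def S_def c_def by (rule evanescent_ratio_sq_diff)
  have S2: "S\<^sup>2 = (1 - c) * (1 + c) / (2 + c)\<^sup>2"
    unfolding S_def oscillating_ratio_def power_divide sin_squared_eq c_def
    by (simp add: power2_eq_square algebra_simps)
  have "(1 - c) ^ 4 / (27 * (2 + c)\<^sup>2) \<ge> 0" by simp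
  then have "S\<^sup>2 \<le> T\<^sup>2" using diff by linarith
  then have ST: "S \<le> T" using T by (simp add: power2_le_iff_abs_le S less_imp_le)
  have "2 * S * T * (1 - cosh b * cos a) + (T\<^sup>2 - S\<^sup>2) * sin a * sinh b = 0"
    using sin_mult_discrete_char[of \<theta> N] zero by (simp add: a_def b_def S_def T_def)
  then have "2 * S * T * (cosh b * cos a - 1) = (T\<^sup>2 - S\<^sup>2) * sin a * sinh b" by algebra
  then have "2 * S * T * \<bar>cosh b * cos a - 1\<bar> = \<bar>(T\<^sup>2 - S\<^sup>2) * sin a * sinh b\<bar>"
    using S T by (metis abs_mult abs_of_pos mult_pos_pos zero_less_numeral)
  also have "\<dots> = (T\<^sup>2 - S\<^sup>2) * sinh b * \<bar>sin a\<bar>"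
    using \<open>S\<^sup>2 \<le> T\<^sup>2\<close> b by (simp add: abs_mult)
  also have "\<dots> \<le> (T\<^sup>2 - S\<^sup>2) * sinh b * 1"
    using \<open>S\<^sup>2 \<le> T\<^sup>2\<close> b by (intro mult_left_mono) auto
  finally have 1: "2 * S * T * \<bar>cosh b * cos a - 1\<bar> \<le> (T\<^sup>2 - S\<^sup>2) * sinh b" by simp
  have "2 * S\<^sup>2 * \<bar>cosh b * cos a - 1\<bar> \<le> 2 * S * T * \<bar>cosh b * cos a - 1\<bar>"
    using S ST by (intro mult_right_mono) (auto simp: power2_eq_square)
  with 1 have "2 * S\<^sup>2 * \<bar>cosh b * cos a - 1\<bar> \<le> (T\<^sup>2 - S\<^sup>2) * sinh b" by linarith
  also have "T\<^sup>2 - S\<^sup>2 = 2 * S\<^sup>2 * ((1 - c) ^ 3 / (54 * (1 + c)))"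
  proof -
    have "2 + c \<noteq> 0" "1 + c \<noteq> 0" using c by auto
    then show ?thesis unfolding diff unfolding S2 by (simp add: divide_simps) algebra
  qed
  finally have "2 * S\<^sup>2 * \<bar>cosh b * cos a - 1\<bar> \<le> 2 * S\<^sup>2 * ((1 - c) ^ 3 / (54 * (1 + c)) * sinh b)"
    by (simp add: mult.assoc)
  then have "\<bar>cosh b * cos a - 1\<bar> \<le> (1 - c) ^ 3 / (54 * (1 + c)) * sinh b"
    by (rule mult_left_le_imp_le) (use S in simp)
  then show ?thesis by (simp add: a_def b_def c_def)
qed

text \<open>The consistency of the scheme. The absence of lower-order terms in these expansions is where the Hermitian derivative pays off:
the terms of relative order \<open>\<theta>\<^sup>2\<close> cancel.\<close>

lemma evanescent_rate_expansion:
  "(\<lambda>\<theta>. evanescent_rate \<theta> - \<theta>) \<in> O[at_right 0](\<lambda>\<theta>. \<theta> ^ 5)"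
  unfolding evanescent_rate_def arcosh_real_def[OF cosh_evanescent_arg] by real_asymp

lemma dispersion_expansion: "(\<lambda>\<theta>. dispersion \<theta> - \<theta> ^ 4) \<in> O[at_right 0](\<lambda>\<theta>. \<theta> ^ 8)"
  unfolding dispersion_def by real_asymp

lemma coupling_expansion:
  "(\<lambda>\<theta>. (1 - cos \<theta>) ^ 3 / (54 * (1 + cos \<theta>))) \<in> O[at_right 0](\<lambda>\<theta>::real. \<theta> ^ 4)"
  by real_asymp

lemma bigo_at_right_0D:
  fixes f :: "real \<Rightarrow> real"
  assumes "f \<in> O[at_right 0](\<lambda>\<theta>. \<theta> ^ n)"
  shows "\<exists>\<delta>>0. \<exists>C>0. \<forall>\<theta>. 0 < \<theta> \<longrightarrow> \<theta> < \<delta> \<longrightarrow> \<bar>f \<theta>\<bar> \<le> C * \<theta> ^ n"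
proof -
  obtain C where C: "C > 0" "eventually (\<lambda>\<theta>. norm (f \<theta>) \<le> C * norm (\<theta> ^ n)) (at_right 0)"
    using landau_o.bigE[OF assms] by blast
  obtain \<delta> where "\<delta> > 0" "\<forall>\<theta>>0. \<theta> < \<delta> \<longrightarrow> norm (f \<theta>) \<le> C * norm (\<theta> ^ n)"
    using C(2) unfolding eventually_at_right[OF zero_less_one] by blast
  then show ?thesis using C(1)
    by (intro exI[of _ \<delta>] conjI exI[of _ C]) (auto simp: power_abs)
qed

lemma small_angle_bounds:
  obtains \<delta> C where "\<delta> > 0" "C > 0"
    "\<And>\<theta>. 0 < \<theta> \<Longrightarrow> \<theta> < \<delta> \<Longrightarrow> \<bar>evanescent_rate \<theta> - \<theta>\<bar> \<le> C * \<theta> ^ 5"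
    "\<And>\<theta>. 0 < \<theta> \<Longrightarrow> \<theta> < \<delta> \<Longrightarrow> \<bar>dispersion \<theta> - \<theta> ^ 4\<bar> \<le> C * \<theta> ^ 8"
    "\<And>\<theta>. 0 < \<theta> \<Longrightarrow> \<theta> < \<delta> \<Longrightarrow> (1 - cos \<theta>) ^ 3 / (54 * (1 + cos \<theta>)) \<le> C * \<theta> ^ 4"
proof -
  obtain \<delta>1 C1 where 1: "\<delta>1 > 0" "C1 > 0"
    "\<forall>\<theta>. 0 < \<theta> \<longrightarrow> \<theta> < \<delta>1 \<longrightarrow> \<bar>evanescent_rate \<theta> - \<theta>\<bar> \<le> C1 * \<theta> ^ 5"
    using bigo_at_right_0D[OF evanescent_rate_expansion] by blast
  obtain \<delta>2 C2 where 2: "\<delta>2 > 0" "C2 > 0"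
    "\<forall>\<theta>. 0 < \<theta> \<longrightarrow> \<theta> < \<delta>2 \<longrightarrow> \<bar>dispersion \<theta> - \<theta> ^ 4\<bar> \<le> C2 * \<theta> ^ 8"
    using bigo_at_right_0D[OF dispersion_expansion] by blast
  obtain \<delta>3 C3 :: real where 3: "\<delta>3 > 0" "C3 > 0"
    "\<forall>\<theta>. 0 < \<theta> \<longrightarrow> \<theta> < \<delta>3 \<longrightarrow> \<bar>(1 - cos \<theta>) ^ 3 / (54 * (1 + cos \<theta>))\<bar> \<le> C3 * \<theta> ^ 4"
    using bigo_at_right_0D[OF coupling_expansion] by blast
  show ?thesis
  proof (rule that[of "min \<delta>1 (min \<delta>2 \<delta>3)" "C1 + C2 + C3"])
    fix \<theta> :: real assume \<theta>: "0 < \<theta>" "\<theta> < min \<delta>1 (min \<delta>2 \<delta>3)"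
    have le: "\<theta> < \<delta>1" "\<theta> < \<delta>2" "\<theta> < \<delta>3" using \<theta>(2) by auto
    have m: "C1 * \<theta> ^ n \<le> (C1 + C2 + C3) * \<theta> ^ n" "C2 * \<theta> ^ n \<le> (C1 + C2 + C3) * \<theta> ^ n"
      "C3 * \<theta> ^ n \<le> (C1 + C2 + C3) * \<theta> ^ n" for n
      using \<theta>(1) 1(2) 2(2) 3(2) by (simp_all add: mult_right_mono)
    show "\<bar>evanescent_rate \<theta> - \<theta>\<bar> \<le> (C1 + C2 + C3) * \<theta> ^ 5"
      using 1(3)[rule_format, OF \<theta>(1) le(1)] m(1)[of 5] by (rule order_trans)
    show "\<bar>dispersion \<theta> - \<theta> ^ 4\<bar> \<le> (C1 + C2 + C3) * \<theta> ^ 8"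
      using 2(3)[rule_format, OF \<theta>(1) le(2)] m(2)[of 8] by (rule order_trans)
    show "(1 - cos \<theta>) ^ 3 / (54 * (1 + cos \<theta>)) \<le> (C1 + C2 + C3) * \<theta> ^ 4"
      using order_trans[OF abs_ge_self 3(3)[rule_format, OF \<theta>(1) le(3)]] m(3)[of 4] by (rule order_trans)
  qed (use 1(1,2) 2(1,2) 3(1,2) in auto)
qed

lemma cosh_Lipschitz:
  assumes "x \<in> {0..M}" "y \<in> {0..M}"
  shows "\<bar>cosh x - cosh y\<bar> \<le> cosh M * \<bar>x - y :: real\<bar>"
proof -
  have "norm (cosh x - cosh y) \<le> cosh M * norm (x - y)"
  proof (rule field_differentiable_bound)
    fix z assume z: "z \<in> {0..M}"
    show "(cosh has_field_derivative sinh z) (at z within {0..M})"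
      by (auto intro!: derivative_eq_intros)
    have "\<bar>sinh z\<bar> \<le> cosh z" using z by (simp add: sinh_le_cosh_real)
    also have "\<dots> \<le> cosh M" using z by (simp add: cosh_real_nonneg_le_iff)
    finally show "norm (sinh z) \<le> cosh M" by simp
  qed (use assms in auto)
  then show ?thesis by simp
qed

lemma power4_Lipschitz:
  fixes x y :: real
  assumes "x \<in> {0..M}" "y \<in> {0..M}"
  shows "\<bar>x ^ 4 - y ^ 4\<bar> \<le> 4 * M ^ 3 * \<bar>x - y\<bar>"
proof -
  have "norm (x ^ 4 - y ^ 4) \<le> 4 * M ^ 3 * norm (x - y)"
  proof (rule field_differentiable_bound)
    fix z assume z: "z \<in> {0..M}"
    show "((\<lambda>x. x ^ 4) has_field_derivative 4 * z ^ 3) (at z within {0..M})"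
      by (auto intro!: derivative_eq_intros)
    show "norm (4 * z ^ 3) \<le> 4 * M ^ 3" using z by (simp add: power_mono)
  qed (use assms in auto)
  then show ?thesis by simp
qed

text \<open>The expansions hold for small \<open>\<theta>\<close>, that is for large \<open>N\<close>, since \<open>\<theta> < (k + 1) \<pi> / N\<close>. Consistency bounds the residual
of \<open>a = N \<theta>\<close> in the continuous characteristic equation, and \<open>clamped_root_distance\<close> turns it into a bound for \<open>|a - w\<^sub>k|\<close>.\<close>

lemma eigenvalue_error_asymptotic:
  assumes k: "k \<ge> 1"
  shows "\<exists>K N0. \<forall>N\<ge>N0. \<bar>biharmonic_eigenvalue k - discrete_eigenvalue N k\<bar> \<le> K * mesh N ^ 4"
proof -
  obtain \<delta> C where \<delta>: "\<delta> > 0" and C: "C > 0"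
    and rate: "\<And>\<theta>. 0 < \<theta> \<Longrightarrow> \<theta> < \<delta> \<Longrightarrow> \<bar>evanescent_rate \<theta> - \<theta>\<bar> \<le> C * \<theta> ^ 5"
    and disp: "\<And>\<theta>. 0 < \<theta> \<Longrightarrow> \<theta> < \<delta> \<Longrightarrow> \<bar>dispersion \<theta> - \<theta> ^ 4\<bar> \<le> C * \<theta> ^ 8"
    and coup: "\<And>\<theta>. 0 < \<theta> \<Longrightarrow> \<theta> < \<delta> \<Longrightarrow> (1 - cos \<theta>) ^ 3 / (54 * (1 + cos \<theta>)) \<le> C * \<theta> ^ 4"
    by (rule small_angle_bounds) blast
  define L where "L = (real k + 1) * pi"
  define M where "M = L + C * L ^ 5"
  define w where "w = clamped_root k"
  define g where "g = cosh (real k * pi) - 1"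
  define K1 where "K1 = (C * L ^ 5 + C * L ^ 4) * cosh M"
  define K where "K = 4 * L ^ 3 * (pi * K1 / g) + C * L ^ 8"
  have L: "L > 0" by (simp add: L_def add_pos_nonneg)
  have g: "g > 0" using cosh_gt_one[of "real k * pi"] k by (simp add: g_def)
  have w: "w \<in> {0..L}" using clamped_root[OF k] clamped_root_pos[OF k] by (auto simp: w_def L_def)
  obtain N1 where N1: "real N1 > L / \<delta>" using reals_Archimedean2 by blast
  have "\<bar>biharmonic_eigenvalue k - discrete_eigenvalue N k\<bar> \<le> K * mesh N ^ 4"
    if N: "N \<ge> max N1 (max 3 (k + 1))" for N
  proof -
    have Nk: "N \<ge> 3" "k \<in> {1..<N}" and N1': "N1 \<le> N" using N k by auto
    have Npos: "real N \<ge> 1" using Nk by simp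
    define h where "h = mesh N"
    have h: "h > 0" "h \<le> 1" "real N * h = 1" using Npos by (auto simp: h_def mesh_def)
    define \<theta> where "\<theta> = discrete_angle N k"
    define a b where "a = \<theta> * real N" and "b = evanescent_rate \<theta> * real N"
    note ang = discrete_angle[OF Nk(2), folded \<theta>_def] discrete_angle_bounds[OF Nk(2), folded \<theta>_def]
    have a: "real k * pi < a" "a < L"
      using ang(1,2) Npos by (auto simp: a_def L_def field_simps)
    have a0: "0 < a" using ang(4) Npos by (simp add: a_def)
    have \<theta>h: "\<theta> = a * h" using h(3) by (simp add: a_def)
    have "L < \<delta> * real N1" using N1 \<delta> by (simp add: field_simps)
    also have "\<dots> \<le> \<delta> * real N" using N1' \<delta> by simp
    finally have "a * h < \<delta> * real N * h" using a h(1) by simp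
    then have small: "\<theta> < \<delta>" using h(3) by (simp add: \<theta>h mult.assoc)
    have pow: "a ^ n \<le> L ^ n" for n using a a0 by (intro power_mono) auto
    have ab: "\<bar>b - a\<bar> \<le> C * L ^ 5 * h ^ 4"
    proof -
      have "b - a = real N * (evanescent_rate \<theta> - \<theta>)" by (simp add: a_def b_def algebra_simps)
      then have "\<bar>b - a\<bar> = real N * \<bar>evanescent_rate \<theta> - \<theta>\<bar>" by (simp add: abs_mult)
      also have "\<dots> \<le> real N * (C * \<theta> ^ 5)" using rate[OF ang(4) small] by (intro mult_left_mono) auto
      also have "\<dots> = C * a ^ 5 * h ^ 4 * (real N * h)" unfolding \<theta>h by (simp add: power_mult_distrib eval_nat_numeral)
      also have "\<dots> \<le> C * L ^ 5 * h ^ 4" using pow[of 5] C h by (simp add: mult_right_mono)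
      finally show ?thesis .
    qed
    have h4: "h ^ 4 \<le> 1" using h by (intro power_le_one) auto
    have "C * L ^ 5 * h ^ 4 \<le> C * L ^ 5" using h4 C L by (simp add: mult_left_le)
    then have bM: "b \<in> {0..M}"
      using ab a evanescent_rate_nonneg[of \<theta>] by (auto simp: M_def b_def)
    have aM: "a \<in> {0..M}" using a a0 C L by (auto simp: M_def intro: order_trans[of a L])
    have "\<bar>cos a * (cosh a - cosh b)\<bar> \<le> 1 * \<bar>cosh a - cosh b\<bar>"
      unfolding abs_mult by (intro mult_right_mono) auto
    also have "\<dots> \<le> cosh M * \<bar>a - b\<bar>" using cosh_Lipschitz[OF aM bM] by simp
    also have "\<dots> \<le> cosh M * (C * L ^ 5 * h ^ 4)" using ab by (intro mult_left_mono) auto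
    finally have 1: "\<bar>cos a * (cosh a - cosh b)\<bar> \<le> cosh M * (C * L ^ 5 * h ^ 4)" .
    have "\<bar>cosh b * cos a - 1\<bar> \<le> (1 - cos \<theta>) ^ 3 / (54 * (1 + cos \<theta>)) * sinh b"
      using discrete_char_zero_bound[OF ang(4,5,3)] by (simp add: a_def b_def)
    also have "\<dots> \<le> (C * \<theta> ^ 4) * sinh b"
      using coup[OF ang(4) small] bM by (intro mult_right_mono) auto
    also have "\<dots> \<le> (C * \<theta> ^ 4) * cosh M"
    proof -
      have "sinh b \<le> cosh b" by (rule sinh_le_cosh_real)
      also have "\<dots> \<le> cosh M" using bM by (simp add: cosh_real_nonneg_le_iff)
      finally show ?thesis using C ang(4) by (intro mult_left_mono) auto
    qed
    also have "\<dots> = C * cosh M * h ^ 4 * a ^ 4" by (simp add: \<theta>h power_mult_distrib)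
    also have "\<dots> \<le> C * cosh M * h ^ 4 * L ^ 4" using pow[of 4] C h by (intro mult_left_mono) auto
    finally have 2: "\<bar>cosh b * cos a - 1\<bar> \<le> C * cosh M * h ^ 4 * L ^ 4" .
    have "clamped_char a = cos a * (cosh a - cosh b) + (cosh b * cos a - 1)"
      by (simp add: clamped_char_def algebra_simps)
    then have "\<bar>clamped_char a\<bar> \<le> cosh M * (C * L ^ 5 * h ^ 4) + C * cosh M * h ^ 4 * L ^ 4"
      using 1 2 by linarith
    also have "\<dots> = K1 * h ^ 4" by (simp add: K1_def algebra_simps)
    finally have char: "\<bar>clamped_char a\<bar> \<le> K1 * h ^ 4" .
    have "g * \<bar>a - w\<bar> \<le> pi * \<bar>clamped_char a\<bar>"
      unfolding g_def w_def using a by (intro clamped_root_distance[OF k]) (auto simp: L_def)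
    also have "\<dots> \<le> pi * (K1 * h ^ 4)" using char by (intro mult_left_mono) auto
    finally have "\<bar>a - w\<bar> \<le> pi * K1 / g * h ^ 4" using g by (simp add: field_simps)
    then have "4 * L ^ 3 * \<bar>a - w\<bar> \<le> 4 * L ^ 3 * (pi * K1 / g * h ^ 4)"
      using L by (intro mult_left_mono) auto
    moreover have "\<bar>a ^ 4 - w ^ 4\<bar> \<le> 4 * L ^ 3 * \<bar>a - w\<bar>"
      using a a0 w by (intro power4_Lipschitz) auto
    ultimately have 3: "\<bar>a ^ 4 - w ^ 4\<bar> \<le> 4 * L ^ 3 * (pi * K1 / g) * h ^ 4" by (simp add: mult.assoc)
    have "real N ^ 4 * dispersion \<theta> - a ^ 4 = real N ^ 4 * (dispersion \<theta> - \<theta> ^ 4)"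
      by (simp add: a_def power_mult_distrib algebra_simps)
    then have "\<bar>real N ^ 4 * dispersion \<theta> - a ^ 4\<bar> = real N ^ 4 * \<bar>dispersion \<theta> - \<theta> ^ 4\<bar>"
      by (simp add: abs_mult)
    also have "\<dots> \<le> real N ^ 4 * (C * \<theta> ^ 8)" using disp[OF ang(4) small] by (intro mult_left_mono) auto
    also have "\<dots> = C * a ^ 8 * h ^ 4 * (real N * h) ^ 4"
      unfolding \<theta>h by (simp add: power_mult_distrib eval_nat_numeral)
    also have "\<dots> \<le> C * L ^ 8 * h ^ 4" using pow[of 8] C h by (simp add: mult_right_mono)
    finally have 4: "\<bar>real N ^ 4 * dispersion \<theta> - a ^ 4\<bar> \<le> C * L ^ 8 * h ^ 4" .
    have "\<bar>w ^ 4 - real N ^ 4 * dispersion \<theta>\<bar> \<le> 4 * L ^ 3 * (pi * K1 / g) * h ^ 4 + C * L ^ 8 * h ^ 4"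
      using 3 4 by linarith
    then show ?thesis
      unfolding biharmonic_eigenvalue_eq[OF k] discrete_eigenvalue_eq_dispersion[OF Nk] K_def
        w_def[symmetric] \<theta>_def[symmetric] h_def[symmetric] by (simp add: distrib_right)
  qed
  then show ?thesis by blast
qed

theorem theorem7p14:
  fixes k :: nat
  assumes "k \<ge> 1"
  shows "\<exists>C>0. \<forall>N\<ge>k + 1.
    \<bar>biharmonic_eigenvalue k - discrete_eigenvalue N k\<bar> \<le> C * mesh N ^ 4"
proof -
  let ?e = "\<lambda>N. \<bar>biharmonic_eigenvalue k - discrete_eigenvalue N k\<bar>"
  obtain K N0 where K: "\<And>N. N \<ge> N0 \<Longrightarrow> ?e N \<le> K * mesh N ^ 4"
    using eigenvalue_error_asymptotic[OF assms] by blast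
  \<comment> \<open>The finitely many coarse grids contribute their individual ratios of error to \<open>h\<^sup>4\<close>.\<close>
  define F where "F = (\<Sum>N\<in>{1..N0}. ?e N / mesh N ^ 4)"
  have F: "F \<ge> 0" unfolding F_def by (intro sum_nonneg) auto
  have "?e N \<le> (\<bar>K\<bar> + F + 1) * mesh N ^ 4" if N: "N \<ge> k + 1" for N
  proof -
    have m: "mesh N ^ 4 > 0" using N by (simp add: mesh_def)
    have "?e N / mesh N ^ 4 \<le> \<bar>K\<bar> + F + 1"
    proof (cases "N \<ge> N0")
      case True
      then have "?e N / mesh N ^ 4 \<le> K" using K[OF True] m by (simp add: divide_le_eq)
      then show ?thesis using F by linarith
    next
      case False
      have "?e N / mesh N ^ 4 \<le> F"
        unfolding F_def using N False
        by (intro member_le_sum[of N "{1..N0}" "\<lambda>N. ?e N / mesh N ^ 4"]) auto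
      then show ?thesis by linarith
    qed
    then show ?thesis using m by (simp add: divide_le_eq)
  qed
  moreover have "\<bar>K\<bar> + F + 1 > 0" using F by linarith
  ultimately show ?thesis by blast
qed

end
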